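(* For every $n\ge3$, the space $\mathcal W_n$ is a finitely generated module over $\mathcal A_{n,\mathbb C}$, and $$\mathcal W_n=\sum_{(\boldsymbol b,\boldsymbol a)\in\mathfrak R_n}\mathcal A_{n,\mathbb C}\,P_{\boldsymbol b,\boldsymbol a},$$ where $\mathfrak R_n$ is the set of reduced admissible pairs.
   Context: $\mathcal M_n=\{(A_i,\ell_i)_{i=1}^n\in(\mathbb C^3\oplus(\mathbb C^3)^* )^n\mid \ell_iA_i=0,\ i=1,\dots,n\}$ ($A_i$ columns, $\ell_i$ rows), with coordinate ring $\mathbb C[\mathcal M_n]$. $SL(3,\mathbb C)$ acts by $A_i\mapsto GA_i$, $\ell_i\mapsto\ell_iG^{-1}$, and $\mathbb T_n=(\mathbb C^\times)^n$ acts by $A_i\mapsto t_iA_i$, $\ell_i\mapsto t_i^{-1}\ell_i$. Define $$\mathcal W_n=\{H\in\mathbb C[\mathcal M_n]^{SL(3,\mathbb C)}\mid H(\mathbf t\cdot z)=(t_1\cdots t_n)^{-3}H(z)\ \ \forall\,\mathbf t\in\mathbb T_n\}.$$ $\mathcal A_{n,\mathbb C}$ is the complex algebra of polynomial absolute projective differential invariants, identified with $\mathbb C[\mathcal M_n]^{SL(3,\mathbb C)\times\mathbb T_n}$; it acts on $\mathcal W_n$ by multiplication. On $\mathcal M_n$ put $C_{ij}=\ell_iA_j$ and, for a triple $I=\{i<j<k\}$, $D_I=\det(\ell_i,\ell_j,\ell_k)$. Let $\mathcal T_n=\{I\subset\{1,\dots,n\}\mid|I|=3\}$. Consider vectors $\boldsymbol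 b=(b_I)_{I\in\mathcal T_n}$ with $b_I\in\mathbb Z_{\ge0}$ and $n\times n$ matrices $\boldsymbol a=(a_{ij})$ with $a_{ij}\in\mathbb Z_{\ge0}$, $a_{ii}=0$. Put $|\boldsymbol b|=\sum_I b_I$, $d_{\boldsymbol b}(i)=\sum_{I\ni i}b_I$, $\partial_{\boldsymbol a}(i)=\sum_{j}a_{ij}-\sum_{j}a_{ji}$. The pair $(\boldsymbol b,\boldsymbol a)$ is admissible if $|\boldsymbol b|=n$ and $d_{\boldsymbol b}(i)+\partial_{\boldsymbol a}(i)=3$ for all $i$. For an admissible pair, $P_{\boldsymbol b,\boldsymbol a}=\prod_{I\in\mathcal T_n}D_I^{b_I}\prod_{i\ne j}C_{ij}^{a_{ij}}$. For a cycle $\gamma=(i_1\,\dots\,i_r)\in S_n$, $r\ge2$, let $Z_\gamma=C_{i_1i_2}C_{i_2i_3}\cdots C_{i_ri_1}$. An admissible pair is reduced if the monomial $\prod_{i\ne j}C_{ij}^{a_{ij}}$ is not divisible (as a monomial in the symbols $C_{ij}$) by any $Z_\gamma$; i.e. there are no distinct indices $i_1,\dots,i_r$, $r\ge2$, with $a_{i_1i_2},\dots,a_{i_ri_1}$ all positive. *)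

theory Defs
  imports "HOL-Analysis.Determinants" "HOL-Algebra.Module"
begin

text \<open>
  A point of \<open>(\<complex>\<^sup>3 \<oplus> (\<complex>\<^sup>3)\<^sup>*)\<^sup>n\<close> is a function on the index set \<open>{1..n}\<close> (extensional, so that it
  carries no further data); \<open>fst (z i)\<close> is the column \<open>A\<^sub>i\<close> and \<open>snd (z i)\<close> the row \<open>\<ell>\<^sub>i\<close>.
\<close>

type_synonym point = "nat \<Rightarrow> (complex^3) \<times> (complex^3)"

abbreviation Acol :: "point \<Rightarrow> nat \<Rightarrow> complex^3" where "Acol z i \<equiv> fst (z i)"
abbreviation lrow :: "point \<Rightarrow> nat \<Rightarrow> complex^3" where "lrow z i \<equiv> snd (z i)"

definition MM :: "nat \<Rightarrow> point set" where
  "MM n = {z \<in> {1..n} \<rightarrow>\<^sub>E UNIV. \<forall>i\<in>{1..n}. scalar_product (lrow z i) (Acol z i) = 0}"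

definition sl3 :: "(complex^3^3) set" where
  "sl3 = {G. det G = 1}"

definition sl3_act :: "nat \<Rightarrow> complex^3^3 \<Rightarrow> point \<Rightarrow> point" where
  "sl3_act n G z = (\<lambda>i\<in>{1..n}. (G *v Acol z i, lrow z i v* matrix_inv G))"

definition torus :: "nat \<Rightarrow> (nat \<Rightarrow> complex) set" where
  "torus n = {1..n} \<rightarrow>\<^sub>E (UNIV - {0})"

definition torus_act :: "nat \<Rightarrow> (nat \<Rightarrow> complex) \<Rightarrow> point \<Rightarrow> point" where
  "torus_act n t z = (\<lambda>i\<in>{1..n}. (t i *s Acol z i, inverse (t i) *s lrow z i))"

text \<open>
  The coordinate ring is realised as the ring of polynomial functions on \<open>MM n\<close>: the algebra of
  functions generated by the constants and the \<open>6 n\<close> coordinates. This loses nothing, since the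
  ideal \<open>(\<ell>\<^sub>1A\<^sub>1, \<dots>, \<ell>\<^sub>nA\<^sub>n)\<close> is prime (each \<open>\<ell>\<^sub>iA\<^sub>i\<close> is a quadratic form of rank \<open>6\<close> in its own variables),
  hence is the full vanishing ideal of \<open>MM n\<close>. Functions are extensional, i.e. \<open>undefined\<close> off \<open>MM n\<close>.
\<close>

inductive_set poly_funs :: "nat \<Rightarrow> (point \<Rightarrow> complex) set" for n where
  const: "(\<lambda>z\<in>MM n. c) \<in> poly_funs n"
| col: "i \<in> {1..n} \<Longrightarrow> (\<lambda>z\<in>MM n. Acol z i $ k) \<in> poly_funs n"
| row: "i \<in> {1..n} \<Longrightarrow> (\<lambda>z\<in>MM n. lrow z i $ k) \<in> poly_funs n"
| add: "f \<in> poly_funs n \<Longrightarrow> g \<in> poly_funs n \<Longrightarrow> (\<lambda>z\<in>MM n. f z + g z) \<in> poly_funs n"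
| mult: "f \<in> poly_funs n \<Longrightarrow> g \<in> poly_funs n \<Longrightarrow> (\<lambda>z\<in>MM n. f z * g z) \<in> poly_funs n"

definition sl3_invariant :: "nat \<Rightarrow> (point \<Rightarrow> complex) \<Rightarrow> bool" where
  "sl3_invariant n H \<longleftrightarrow> (\<forall>G\<in>sl3. \<forall>z\<in>MM n. H (sl3_act n G z) = H z)"

definition torus_invariant :: "nat \<Rightarrow> (point \<Rightarrow> complex) \<Rightarrow> bool" where
  "torus_invariant n H \<longleftrightarrow> (\<forall>t\<in>torus n. \<forall>z\<in>MM n. H (torus_act n t z) = H z)"

definition torus_weight_m3 :: "nat \<Rightarrow> (point \<Rightarrow> complex) \<Rightarrow> bool" where
  "torus_weight_m3 n H \<longleftrightarrow>
     (\<forall>t\<in>torus n. \<forall>z\<in>MM n. H (torus_act n t z) = (\<Prod>i\<in>{1..n}. t i) powi (-3) * H z)"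

definition AA :: "nat \<Rightarrow> (point \<Rightarrow> complex) ring" where
  "AA n = \<lparr>carrier = {H \<in> poly_funs n. sl3_invariant n H \<and> torus_invariant n H},
     mult = (\<lambda>f g. \<lambda>z\<in>MM n. f z * g z), one = (\<lambda>z\<in>MM n. 1),
     zero = (\<lambda>z\<in>MM n. 0), add = (\<lambda>f g. \<lambda>z\<in>MM n. f z + g z)\<rparr>"

text \<open>
  The library's module records extend ring records, so the fields \<open>mult\<close> and \<open>one\<close> have to be filled
  in although they play no role in the module structure.
\<close>

definition WW :: "nat \<Rightarrow> (point \<Rightarrow> complex, point \<Rightarrow> complex) module" where
  "WW n = \<lparr>carrier = {H \<in> poly_funs n. sl3_invariant n H \<and> torus_weight_m3 n H},
     mult = (\<lambda>f g. \<lambda>z\<in>MM n. f z * g z), one = (\<lambda>z\<in>MM n. 1),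
     zero = (\<lambda>z\<in>MM n. 0), add = (\<lambda>f g. \<lambda>z\<in>MM n. f z + g z),
     smult = (\<lambda>f g. \<lambda>z\<in>MM n. f z * g z)\<rparr>"

text \<open>\<open>lin_span R M S\<close> is the sum of the \<open>R x\<close> over \<open>x \<in> S\<close>, for \<open>S \<subseteq> carrier M\<close>.\<close>

definition lin_span :: "('r, 'k) ring_scheme \<Rightarrow> ('r, 'm, 'l) module_scheme \<Rightarrow> 'm set \<Rightarrow> 'm set" where
  "lin_span R M S =
     {\<Oplus>\<^bsub>M\<^esub>x\<in>F. c x \<odot>\<^bsub>M\<^esub> x | F c. finite F \<and> F \<subseteq> S \<and> c \<in> F \<rightarrow> carrier R}"

definition fin_gen_module :: "('r, 'k) ring_scheme \<Rightarrow> ('r, 'm, 'l) module_scheme \<Rightarrow> bool" where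
  "fin_gen_module R M \<longleftrightarrow> Module.module R M \<and>
     (\<exists>S. finite S \<and> S \<subseteq> carrier M \<and> carrier M = lin_span R M S)"

definition CC :: "nat \<Rightarrow> nat \<Rightarrow> point \<Rightarrow> complex" where
  "CC i j z = scalar_product (lrow z i) (Acol z j)"

definition triples :: "nat \<Rightarrow> nat set set" where
  "triples n = {I. I \<subseteq> {1..n} \<and> card I = 3}"

text \<open>Listing \<open>I\<close> in increasing order fixes the sign of the determinant.\<close>

definition DD :: "nat set \<Rightarrow> point \<Rightarrow> complex" where
  "DD I z = det (vector (map (lrow z) (sorted_list_of_set I)) :: complex^3^3)"

text \<open>
  Exponent data are total functions vanishing outside their index sets, so that they correspond
  bijectively to the vectors \<open>(b\<^sub>I)\<close> and matrices \<open>(a\<^sub>i\<^sub>j)\<close> with zero diagonal.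
\<close>

definition exponents :: "nat \<Rightarrow> ((nat set \<Rightarrow> nat) \<times> (nat \<Rightarrow> nat \<Rightarrow> nat)) set" where
  "exponents n = {(b, a). (\<forall>I. I \<notin> triples n \<longrightarrow> b I = 0) \<and>
     (\<forall>i j. i \<notin> {1..n} \<or> j \<notin> {1..n} \<or> i = j \<longrightarrow> a i j = 0)}"

definition bdeg :: "nat \<Rightarrow> (nat set \<Rightarrow> nat) \<Rightarrow> nat \<Rightarrow> nat" where
  "bdeg n b i = (\<Sum>I\<in>{I \<in> triples n. i \<in> I}. b I)"

definition adiv :: "nat \<Rightarrow> (nat \<Rightarrow> nat \<Rightarrow> nat) \<Rightarrow> nat \<Rightarrow> int" where
  "adiv n a i = (\<Sum>j\<in>{1..n}. int (a i j)) - (\<Sum>j\<in>{1..n}. int (a j i))"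

definition admissible :: "nat \<Rightarrow> ((nat set \<Rightarrow> nat) \<times> (nat \<Rightarrow> nat \<Rightarrow> nat)) set" where
  "admissible n = {(b, a) \<in> exponents n.
     (\<Sum>I\<in>triples n. b I) = n \<and> (\<forall>i\<in>{1..n}. int (bdeg n b i) + adiv n a i = 3)}"

definition PP :: "nat \<Rightarrow> (nat set \<Rightarrow> nat) \<Rightarrow> (nat \<Rightarrow> nat \<Rightarrow> nat) \<Rightarrow> point \<Rightarrow> complex" where
  "PP n b a = (\<lambda>z\<in>MM n. (\<Prod>I\<in>triples n. DD I z ^ b I) *
     (\<Prod>(i, j)\<in>{(i, j). i \<in> {1..n} \<and> j \<in> {1..n} \<and> i \<noteq> j}. CC i j z ^ a i j))"

text \<open>
  The list \<open>is\<close> below is a cycle \<open>\<gamma> = (i\<^sub>1 \<dots> i\<^sub>r)\<close>; the factors of \<open>Z\<^sub>\<gamma>\<close> are pairwise different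
  symbols, so \<open>Z\<^sub>\<gamma>\<close> divides the monomial iff all the exponents along the cycle are positive.
\<close>

definition reduced :: "nat \<Rightarrow> ((nat set \<Rightarrow> nat) \<times> (nat \<Rightarrow> nat \<Rightarrow> nat)) set" where
  "reduced n = {(b, a) \<in> admissible n.
     \<not> (\<exists>is. distinct is \<and> set is \<subseteq> {1..n} \<and> 2 \<le> length is \<and>
        (\<forall>k<length is. 0 < a (is ! k) (is ! (Suc k mod length is))))}"

end

theory Submission
  imports Defs "HOL-Computational_Algebra.Polynomial" "HOL-Analysis.Complex_Transcendental"
    "HOL-Library.Multiset"
begin

text \<open>
  The heart of the matter is the first fundamental theorem for \<open>SL\<^sub>3\<close>, obtained on \<open>MM n\<close> from
  Cayley's \<open>\<Omega>\<close>-process. For \<open>H\<close> of weight \<open>-3\<close> the combined \<open>SL\<^sub>3\<close>- and torus-covariance gives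
  \<open>det g ^ n * H (g A, \<ell> adj g) = H (A, det g \<ell>)\<close> for every invertible \<open>g\<close>, and the right-hand side is
  a polynomial in \<open>det g\<close> with coefficients \<open>h\<^sub>p\<close> depending on \<open>z = (A, \<ell>)\<close>. Iterating \<open>\<Omega>\<close> and
  evaluating at \<open>g = 0\<close> isolates a nonzero multiple of \<open>h\<^sub>p\<close>. On the other side, \<open>\<Omega>\<close> preserves the algebra
  generated by the pairings and brackets of the \<open>A\<^sub>i\<close>, the \<open>\<ell>\<^sub>i\<close> and the rows of \<open>g\<close>, so each \<open>h\<^sub>p\<close>, and hence
  \<open>H\<close>, is a polynomial in the \<open>C\<^sub>i\<^sub>j\<close>, the \<open>D\<^sub>I\<close> and the brackets \<open>E\<^sub>I\<close> of columns.

  Only monomials of weight \<open>-3\<close> matter. As \<open>D\<^sub>I E\<^sub>J\<close> is a determinant in the \<open>C\<^sub>i\<^sub>j\<close> and every such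
  monomial has \<open>n\<close> more factors \<open>D\<close> than \<open>E\<close>, all \<open>E\<close> can be eliminated, which leaves the admissible
  \<open>P\<^sub>b\<^sub>,\<^sub>a\<close>; the cycles \<open>Z\<^sub>\<gamma>\<close> then split off as invariant coefficients. In a reduced pair \<open>a\<close> is an acyclic
  flow with bounded divergence, so there are only finitely many of them.
\<close>

section \<open>Cayley's operator\<close>

text \<open>Rows and columns share one type, so one product serves both ways: it sends two covectors
  to a vector and two vectors to a covector.\<close>

definition cross :: "complex^3 \<Rightarrow> complex^3 \<Rightarrow> complex^3" where
  "cross u v = vector [u$2 * v$3 - u$3 * v$2, u$3 * v$1 - u$1 * v$3, u$1 * v$2 - u$2 * v$1]"

definition bracket :: "complex^3 \<Rightarrow> complex^3 \<Rightarrow> complex^3 \<Rightarrow> complex" where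
  "bracket u v w = scalar_product u (cross v w)"

lemma cross_nth [simp]:
  "cross u v $ 1 = u$2 * v$3 - u$3 * v$2"
  "cross u v $ 2 = u$3 * v$1 - u$1 * v$3"
  "cross u v $ 3 = u$1 * v$2 - u$2 * v$1"
  by (simp_all add: cross_def)

lemma scalar_product_3: "scalar_product u v = u$1 * v$1 + u$2 * v$2 + u$3 * (v$3 :: complex)"
  for u v :: "complex^3"
  by (simp add: scalar_product_def sum_3)

lemmas vec3_simps = vec_eq_iff forall_3 scalar_product_3 bracket_def

section \<open>Partial derivatives in the entries of a matrix\<close>

definition pd :: "3 \<Rightarrow> 3 \<Rightarrow> (complex^3^3 \<Rightarrow> complex) \<Rightarrow> complex^3^3 \<Rightarrow> complex" where
  "pd i a f g = deriv (\<lambda>t. f (g + axis i (axis a t))) 0"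

text \<open>\<open>deriv\<close> is total, so \<open>pd\<close> alone says nothing about existence.
  Here \<open>axis i (axis a t)\<close> is \<open>t\<close> times a matrix unit; differentiability
  along the matrix units suffices for the sum, product and chain rules below.\<close>

definition pdiff :: "(complex^3^3 \<Rightarrow> complex) \<Rightarrow> bool" where
  "pdiff f \<longleftrightarrow> (\<forall>i a g. (\<lambda>t. f (g + axis i (axis a t))) field_differentiable (at 0))"

lemma pd_coord_deriv:
  "((\<lambda>t. (g + axis i (axis a t)) $ r $ c) has_field_derivative (if r = i \<and> c = a then 1 else 0))
    (at (0::complex))"
  by (cases "r = i"; cases "c = a") (auto simp: axis_def intro!: derivative_eq_intros)

lemma axis_0 [simp]: "axis i (axis a (0::complex)) = (0 :: complex^3^3)"
  by (simp add: axis_def vec_eq_iff)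

lemma pdiff_const [simp]: "pdiff (\<lambda>g. c)"
  by (simp add: pdiff_def)

lemma pdiff_coord [simp]: "pdiff (\<lambda>g. g $ r $ c)"
  unfolding pdiff_def field_differentiable_def using pd_coord_deriv by blast

lemma pdiff_add [simp]: "pdiff f \<Longrightarrow> pdiff h \<Longrightarrow> pdiff (\<lambda>g. f g + h g)"
  and pdiff_diff [simp]: "pdiff f \<Longrightarrow> pdiff h \<Longrightarrow> pdiff (\<lambda>g. f g - h g)"
  and pdiff_mult [simp]: "pdiff f \<Longrightarrow> pdiff h \<Longrightarrow> pdiff (\<lambda>g. f g * h g)"
  by (simp_all add: pdiff_def field_differentiable_add field_differentiable_diff
      field_differentiable_mult)

lemma pd_const [simp]: "pd i a (\<lambda>g. c) g = 0"
  by (simp add: pd_def)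

lemma pd_coord [simp]: "pd i a (\<lambda>g. g $ r $ c) g = (if r = i \<and> c = a then 1 else 0)"
  unfolding pd_def by (rule DERIV_imp_deriv[OF pd_coord_deriv])

lemma pd_add [simp]: "pdiff f \<Longrightarrow> pdiff h \<Longrightarrow> pd i a (\<lambda>g. f g + h g) g = pd i a f g + pd i a h g"
  and pd_diff [simp]: "pdiff f \<Longrightarrow> pdiff h \<Longrightarrow> pd i a (\<lambda>g. f g - h g) g = pd i a f g - pd i a h g"
  and pd_mult [simp]: "pdiff f \<Longrightarrow> pdiff h \<Longrightarrow>
    pd i a (\<lambda>g. f g * h g) g = f g * pd i a h g + pd i a f g * h g"
  by (simp_all add: pd_def pdiff_def)

lemma pdiff_poly [simp]:
  assumes "pdiff f" shows "pdiff (\<lambda>g. poly q (f g))"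
  using assms unfolding pdiff_def field_differentiable_def
  by (metis DERIV_chain2[OF poly_DERIV])

lemma pd_poly [simp]:
  assumes "pdiff f" shows "pd i a (\<lambda>g. poly q (f g)) g = poly (pderiv q) (f g) * pd i a f g"
proof -
  have "((\<lambda>t. f (g + axis i (axis a t))) has_field_derivative pd i a f g) (at 0)"
    using assms by (simp add: pd_def pdiff_def field_differentiable_derivI)
  from DERIV_chain2[OF poly_DERIV this] show ?thesis
    unfolding pd_def[of i a "\<lambda>g. poly q (f g)"] by (simp add: DERIV_imp_deriv)
qed

section \<open>Vector calculus in one row of the matrix\<close>

definition grad :: "3 \<Rightarrow> (complex^3^3 \<Rightarrow> complex) \<Rightarrow> complex^3^3 \<Rightarrow> complex^3" where
  "grad i f g = vector [pd i 1 f g, pd i 2 f g, pd i 3 f g]"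

definition curl :: "3 \<Rightarrow> (complex^3^3 \<Rightarrow> complex^3) \<Rightarrow> complex^3^3 \<Rightarrow> complex^3" where
  "curl i v g = vector
    [pd i 2 (\<lambda>g. v g $ 3) g - pd i 3 (\<lambda>g. v g $ 2) g,
     pd i 3 (\<lambda>g. v g $ 1) g - pd i 1 (\<lambda>g. v g $ 3) g,
     pd i 1 (\<lambda>g. v g $ 2) g - pd i 2 (\<lambda>g. v g $ 1) g]"

definition diverg :: "3 \<Rightarrow> (complex^3^3 \<Rightarrow> complex^3) \<Rightarrow> complex^3^3 \<Rightarrow> complex" where
  "diverg i v g = pd i 1 (\<lambda>g. v g $ 1) g + pd i 2 (\<lambda>g. v g $ 2) g + pd i 3 (\<lambda>g. v g $ 3) g"

text \<open>Cayley's operator \<open>det (\<partial>/\<partial>g\<^sub>i\<^sub>j)\<close>, with the determinant written as a triple product of the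
  gradients with respect to the three rows.\<close>

definition Omega :: "(complex^3^3 \<Rightarrow> complex) \<Rightarrow> complex^3^3 \<Rightarrow> complex" where
  "Omega f = diverg 1 (curl 2 (grad 3 f))"

lemma grad_nth [simp]:
  "grad i f g $ 1 = pd i 1 f g" "grad i f g $ 2 = pd i 2 f g" "grad i f g $ 3 = pd i 3 f g"
  by (simp_all add: grad_def)

lemma curl_nth [simp]:
  "curl i v g $ 1 = pd i 2 (\<lambda>g. v g $ 3) g - pd i 3 (\<lambda>g. v g $ 2) g"
  "curl i v g $ 2 = pd i 3 (\<lambda>g. v g $ 1) g - pd i 1 (\<lambda>g. v g $ 3) g"
  "curl i v g $ 3 = pd i 1 (\<lambda>g. v g $ 2) g - pd i 2 (\<lambda>g. v g $ 1) g"
  by (simp_all add: curl_def)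

section \<open>Cayley's identity for functions of the determinant\<close>

definition omega_poly :: "complex poly \<Rightarrow> complex poly" where
  "omega_poly q = (let r = pCons 0 (pderiv (pderiv q)) + Polynomial.smult 2 (pderiv q) in pCons 0 (pderiv r) + Polynomial.smult 3 r)"

text \<open>Cayley's identity sends \<open>det^p\<close> to \<open>p (p+1) (p+2) det^(p-1)\<close>;
  here \<open>p = k + 1\<close>.\<close>

lemma coeff_omega_poly:
  "coeff (omega_poly q) k = of_nat ((k + 1) * (k + 2) * (k + 3)) * coeff q (Suc k)"
  by (cases k) (simp_all add: omega_poly_def Let_def coeff_pderiv coeff_pCons algebra_simps)

text \<open>Each application shifts the coefficients down by one with a nonzero integer factor that
  does not depend on \<open>q\<close>; \<open>c\<close> is the product of these factors.\<close>

lemma coeff_omega_poly_iterate: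
  "\<exists>c. c \<noteq> 0 \<and> (\<forall>q. coeff ((omega_poly ^^ k) q) 0 = c * coeff q k)"
proof -
  \<comment> \<open>All positions \<open>j\<close> at once: the step to \<open>Suc k\<close> uses
    the claim at \<open>Suc j\<close>.\<close>
  have "\<exists>c. c \<noteq> 0 \<and> (\<forall>q. coeff ((omega_poly ^^ k) q) j = c * coeff q (j + k))" for j
  proof (induction k arbitrary: j)
    case 0
    then show ?case by (intro exI[of _ 1]) simp
  next
    case (Suc k)
    from Suc[of "Suc j"] obtain c where "c \<noteq> 0"
      "\<And>q. coeff ((omega_poly ^^ k) q) (Suc j) = c * coeff q (Suc (j + k))"
      by auto
    then show ?case
      by (intro exI[of _ "of_nat ((j + 1) * (j + 2) * (j + 3)) * c"])
        (simp only: funpow.simps o_apply coeff_omega_poly, auto simp flip: of_nat_add of_nat_mult)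
  qed
  from this[of 0] show ?thesis by simp
qed

lemma det_bracket: "det g = bracket (g$1) (g$2) (g$3)" for g :: "complex^3^3"
  by (simp add: det_3 vec3_simps algebra_simps)

lemma Omega_poly_det: "Omega (\<lambda>g. poly q (det g)) = (\<lambda>g. poly (omega_poly q) (det g))"
proof -
  have det: "det = (\<lambda>g::complex^3^3. g$1$1 * (g$2$2 * g$3$3 - g$2$3 * g$3$2)
    + g$1$2 * (g$2$3 * g$3$1 - g$2$1 * g$3$3) + g$1$3 * (g$2$1 * g$3$2 - g$2$2 * g$3$1))"
    by (rule ext) (simp add: det_bracket vec3_simps)
  have [simp]: "pdiff det" by (simp add: det)
  define r where "r = pCons 0 (pderiv (pderiv q)) + Polynomial.smult 2 (pderiv q)"
  \<comment> \<open>In the third row \<open>det\<close> is linear with gradient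
    \<open>cross (g$1) (g$2)\<close>.\<close>
  have g1: "grad 3 (\<lambda>g. poly q (det g)) = (\<lambda>g. poly (pderiv q) (det g) *s cross (g$1) (g$2))"
    by (rule ext) (simp add: vec3_simps, simp add: det)
  \<comment> \<open>Differentiating the scalar factor produces
    \<open>cross (cross (g$3) (g$1)) (cross (g$1) (g$2)) = det g *s g$1\<close>, and the curl of
    \<open>cross (g$1) (g$2)\<close> in the second row is \<open>2 *s g$1\<close>; this is the
    source of \<open>r\<close>.\<close>
  have g2: "curl 2 (\<lambda>g. poly (pderiv q) (det g) *s cross (g$1) (g$2)) = (\<lambda>g. poly r (det g) *s (g$1))"
    by (rule ext) (simp add: vec3_simps r_def, simp add: det algebra_simps)
  \<comment> \<open>The gradient of \<open>det\<close> in the first row pairs with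
    \<open>g$1\<close> to \<open>det g\<close>, and the identity field has divergence 3.\<close>
  have g3: "diverg 1 (\<lambda>g. poly r (det g) *s (g$1)) = (\<lambda>g. poly (omega_poly q) (det g))"
    by (rule ext) (simp add: diverg_def omega_poly_def r_def[symmetric] Let_def, simp add: det algebra_simps)
  show ?thesis
    by (simp only: Omega_def g1 g2 g3)
qed

section \<open>The algebra of joint covariants\<close>

text \<open>The point \<open>z\<close> is a parameter; the matrix \<open>g\<close> is the variable
  in which derivatives are taken.\<close>

type_synonym 'v fam = "point \<Rightarrow> complex^3^3 \<Rightarrow> 'v"

text \<open>When \<open>h\<close> acts on the points and \<open>g\<close> is multiplied from the
  right by the inverse of \<open>h\<close>, the rows of \<open>g\<close> move exactly as the
  \<open>l_i\<close> do; they therefore serve as further basic covectors.\<close>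

inductive_set covecs :: "nat \<Rightarrow> (complex^3) fam set" for n where
  row: "i \<in> {1..n} \<Longrightarrow> (\<lambda>z g. lrow z i) \<in> covecs n"
| mat: "(\<lambda>z g. g $ w) \<in> covecs n"

text \<open>Scalars, with \<open>vcov\<close> for vectors and \<open>lcov\<close> for covectors: a
  gradient in a row leads from the first to the second, a curl on to the third, a divergence back to
  the first.\<close>

inductive_set scov :: "nat \<Rightarrow> complex fam set" for n where
  const: "(\<lambda>z g. c) \<in> scov n"
| pairing: "l \<in> covecs n \<Longrightarrow> i \<in> {1..n} \<Longrightarrow> (\<lambda>z g. scalar_product (l z g) (Acol z i)) \<in> scov n"
| rows: "l1 \<in> covecs n \<Longrightarrow> l2 \<in> covecs n \<Longrightarrow> l3 \<in> covecs n \<Longrightarrow>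
    (\<lambda>z g. bracket (l1 z g) (l2 z g) (l3 z g)) \<in> scov n"
| cols: "i \<in> {1..n} \<Longrightarrow> j \<in> {1..n} \<Longrightarrow> k \<in> {1..n} \<Longrightarrow>
    (\<lambda>z g. bracket (Acol z i) (Acol z j) (Acol z k)) \<in> scov n"
| add: "F \<in> scov n \<Longrightarrow> F' \<in> scov n \<Longrightarrow> (\<lambda>z g. F z g + F' z g) \<in> scov n"
| mult: "F \<in> scov n \<Longrightarrow> F' \<in> scov n \<Longrightarrow> (\<lambda>z g. F z g * F' z g) \<in> scov n"

inductive_set vcov :: "nat \<Rightarrow> (complex^3) fam set" for n where
  zero: "(\<lambda>z g. 0) \<in> vcov n"
| col: "i \<in> {1..n} \<Longrightarrow> (\<lambda>z g. Acol z i) \<in> vcov n"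
| cross: "l \<in> covecs n \<Longrightarrow> l' \<in> covecs n \<Longrightarrow> (\<lambda>z g. cross (l z g) (l' z g)) \<in> vcov n"
| add: "v \<in> vcov n \<Longrightarrow> v' \<in> vcov n \<Longrightarrow> (\<lambda>z g. v z g + v' z g) \<in> vcov n"
| scale: "F \<in> scov n \<Longrightarrow> v \<in> vcov n \<Longrightarrow> (\<lambda>z g. F z g *s v z g) \<in> vcov n"

inductive_set lcov :: "nat \<Rightarrow> (complex^3) fam set" for n where
  zero: "(\<lambda>z g. 0) \<in> lcov n"
| covec: "l \<in> covecs n \<Longrightarrow> l \<in> lcov n"
| cross: "i \<in> {1..n} \<Longrightarrow> j \<in> {1..n} \<Longrightarrow> (\<lambda>z g. cross (Acol z i) (Acol z j)) \<in> lcov n"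
| add: "v \<in> lcov n \<Longrightarrow> v' \<in> lcov n \<Longrightarrow> (\<lambda>z g. v z g + v' z g) \<in> lcov n"
| scale: "F \<in> scov n \<Longrightarrow> v \<in> lcov n \<Longrightarrow> (\<lambda>z g. F z g *s v z g) \<in> lcov n"

section \<open>Closure of the covariants under Cayley's operator\<close>

lemma covecs_pdiff [simp]: "l \<in> covecs n \<Longrightarrow> pdiff (\<lambda>g. l z g $ a)"
  by (induction rule: covecs.induct) simp_all

text \<open>A basic covector either is row \<open>i\<close> of the matrix or is constant along it,
  so its Jacobian in that row is a scalar matrix; \<open>\<kappa>\<close> is 1 or 0.\<close>

lemma covecs_pd:
  assumes "l \<in> covecs n"
  obtains \<kappa> where "\<And>a b z g. pd i a (\<lambda>g. l z g $ b) g = (if a = b then \<kappa> else 0)"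
  using assms
proof cases
  case (row j)
  then show ?thesis by (intro that[of 0]) simp
next
  case (mat w)
  then show ?thesis by (intro that[of "if w = i then 1 else 0"]) auto
qed

lemma scov_pdiff [simp]: "F \<in> scov n \<Longrightarrow> pdiff (\<lambda>g. F z g)"
  by (induction rule: scov.induct) (simp_all add: vec3_simps)

lemma vcov_pdiff [simp]:
  assumes "v \<in> vcov n"
  shows "pdiff (\<lambda>g. v z g $ a)"
proof -
  have "\<forall>a. pdiff (\<lambda>g. v z g $ a)"
    using assms by (induction rule: vcov.induct) (simp_all add: forall_3)
  then show ?thesis by blast
qed

lemma lcov_pdiff [simp]:
  assumes "v \<in> lcov n"
  shows "pdiff (\<lambda>g. v z g $ a)"
proof -
  have "\<forall>a. pdiff (\<lambda>g. v z g $ a)"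
    using assms by (induction rule: lcov.induct) (simp_all add: forall_3)
  then show ?thesis by blast
qed

lemma vcov_smult: "v \<in> vcov n \<Longrightarrow> (\<lambda>z g. c *s v z g) \<in> vcov n"
  and lcov_smult: "v \<in> lcov n \<Longrightarrow> (\<lambda>z g. c *s v z g) \<in> lcov n"
  using vcov.scale[OF scov.const] lcov.scale[OF scov.const] by fastforce+

lemma lcov_diff:
  assumes "v \<in> lcov n" "w \<in> lcov n"
  shows "(\<lambda>z g. v z g - w z g) \<in> lcov n"
proof -
  have eq: "(\<lambda>z g. v z g - w z g) = (\<lambda>z g. v z g + (-1) *s w z g)" by (simp add: vec3_simps)
  show ?thesis by (simp only: eq) (intro lcov.add lcov_smult assms)
qed

text \<open>Up to constants, pairings have columns as gradients, and brackets have sums of cross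
  products of two of their covectors; sums and products follow by the Leibniz rule.\<close>

lemma grad_vcov:
  assumes "F \<in> scov n"
  shows "(\<lambda>z g. grad i (F z) g) \<in> vcov n"
  using assms
proof induction
  case (const c)
  have "grad i (\<lambda>g. c) = (\<lambda>g. 0)" by (rule ext) (simp add: vec3_simps)
  then show ?case by (simp add: vcov.zero)
next
  case (pairing l j)
  obtain \<kappa> where \<kappa>: "\<And>a b z g. pd i a (\<lambda>g. l z g $ b) g = (if a = b then \<kappa> else 0)"
    using covecs_pd[OF pairing(1)] by metis
  have "(\<lambda>z g. grad i (\<lambda>g. scalar_product (l z g) (Acol z j)) g) = (\<lambda>z g. \<kappa> *s Acol z j)"
    using pairing by (intro ext) (simp add: vec3_simps \<kappa>)
  then show ?case using pairing by (simp add: vcov_smult vcov.col)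
next
  case (rows l1 l2 l3)
  obtain \<kappa>1 where \<kappa>1: "\<And>a b z g. pd i a (\<lambda>g. l1 z g $ b) g = (if a = b then \<kappa>1 else 0)"
    using covecs_pd[OF rows(1)] by metis
  obtain \<kappa>2 where \<kappa>2: "\<And>a b z g. pd i a (\<lambda>g. l2 z g $ b) g = (if a = b then \<kappa>2 else 0)"
    using covecs_pd[OF rows(2)] by metis
  obtain \<kappa>3 where \<kappa>3: "\<And>a b z g. pd i a (\<lambda>g. l3 z g $ b) g = (if a = b then \<kappa>3 else 0)"
    using covecs_pd[OF rows(3)] by metis
  have "(\<lambda>z g. grad i (\<lambda>g. bracket (l1 z g) (l2 z g) (l3 z g)) g) =
    (\<lambda>z g. \<kappa>1 *s cross (l2 z g) (l3 z g) +
      (\<kappa>2 *s cross (l3 z g) (l1 z g) + \<kappa>3 *s cross (l1 z g) (l2 z g)))"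
    using rows by (intro ext) (simp add: vec3_simps \<kappa>1 \<kappa>2 \<kappa>3 algebra_simps)
  then show ?case using rows by (simp add: vcov_smult vcov.add vcov.cross)
next
  case (cols j k l)
  have "(\<lambda>z g. grad i (\<lambda>g. bracket (Acol z j) (Acol z k) (Acol z l)) g) = (\<lambda>z g. 0)"
    by (intro ext) (simp add: vec3_simps)
  then show ?case by (simp add: vcov.zero)
next
  case (add F F')
  have "(\<lambda>z g. grad i (\<lambda>g. F z g + F' z g) g) = (\<lambda>z g. grad i (F z) g + grad i (F' z) g)"
    using add by (intro ext) (simp add: vec3_simps)
  then show ?case using add by (simp add: vcov.add)
next
  case (mult F F')
  have "(\<lambda>z g. grad i (\<lambda>g. F z g * F' z g) g) =
      (\<lambda>z g. F z g *s grad i (F' z) g + F' z g *s grad i (F z) g)"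
    using mult by (intro ext) (simp add: vec3_simps)
  then show ?case using mult by (simp add: vcov.add vcov.scale)
qed

text \<open>Serves the curl of \<open>F *s v\<close>, which contains the cross product of
  \<open>grad F\<close> with \<open>v\<close>. Bilinearity reduces it to generators, where double
  cross products expand with pairings and brackets as coefficients.\<close>

lemma cross_lcov:
  assumes "v \<in> vcov n" "v' \<in> vcov n"
  shows "(\<lambda>z g. cross (v z g) (v' z g)) \<in> lcov n"
proof -
  have col_left: "(\<lambda>z g. cross (Acol z i) (v z g)) \<in> lcov n" if "i \<in> {1..n}" "v \<in> vcov n" for i v
    using that(2)
  proof induction
    case zero
    have "(\<lambda>z (g::complex^3^3). cross (Acol z i) 0) = (\<lambda>z g. 0)" by (intro ext) (simp add: vec3_simps)
    then show ?case by (simp add: lcov.zero)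
  next
    case (col j)
    then show ?case using that by (intro lcov.cross)
  next
    case (cross l l')
    have "(\<lambda>z g. cross (Acol z i) (cross (l z g) (l' z g))) =
      (\<lambda>z g. scalar_product (l' z g) (Acol z i) *s l z g -
         scalar_product (l z g) (Acol z i) *s l' z g)"
      by (intro ext) (simp add: vec3_simps algebra_simps)
    then show ?case using that cross
      by (simp add: lcov_diff lcov.scale lcov.covec scov.pairing scov.rows)
  next
    case (add v v')
    have "(\<lambda>z g. cross (Acol z i) (v z g + v' z g)) =
      (\<lambda>z g. cross (Acol z i) (v z g) + cross (Acol z i) (v' z g))"
      by (intro ext) (simp add: vec3_simps algebra_simps)
    then show ?case using add by (simp add: lcov.add)
  next
    case (scale F v)
    have "(\<lambda>z g. cross (Acol z i) (F z g *s v z g)) = (\<lambda>z g. F z g *s cross (Acol z i) (v z g))"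
      by (intro ext) (simp add: vec3_simps algebra_simps)
    then show ?case using scale by (simp add: lcov.scale)
  qed
  have cross_left: "(\<lambda>z g. cross (cross (l z g) (l' z g)) (v z g)) \<in> lcov n"
    if "l \<in> covecs n" "l' \<in> covecs n" "v \<in> vcov n" for l l' v
    using that(3)
  proof induction
    case zero
    have "(\<lambda>z g. cross (cross (l z g) (l' z g)) 0) = (\<lambda>z g. 0)" by (intro ext) (simp add: vec3_simps)
    then show ?case by (simp add: lcov.zero)
  next
    case (col i)
    have "(\<lambda>z g. cross (cross (l z g) (l' z g)) (Acol z i)) =
      (\<lambda>z g. scalar_product (l z g) (Acol z i) *s l' z g -
         scalar_product (l' z g) (Acol z i) *s l z g)"
      by (intro ext) (simp add: vec3_simps algebra_simps)
    then show ?case using that col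
      by (simp add: lcov_diff lcov.scale lcov.covec scov.pairing scov.rows)
  next
    case (cross m m')
    have "(\<lambda>z g. cross (cross (l z g) (l' z g)) (cross (m z g) (m' z g))) =
      (\<lambda>z g. bracket (m z g) (m' z g) (l z g) *s l' z g -
         bracket (m z g) (m' z g) (l' z g) *s l z g)"
      by (intro ext) (simp add: vec3_simps algebra_simps)
    then show ?case using that cross
      by (simp add: lcov_diff lcov.scale lcov.covec scov.pairing scov.rows)
  next
    case (add v v')
    have "(\<lambda>z g. cross (cross (l z g) (l' z g)) (v z g + v' z g)) =
      (\<lambda>z g. cross (cross (l z g) (l' z g)) (v z g) + cross (cross (l z g) (l' z g)) (v' z g))"
      by (intro ext) (simp add: vec3_simps algebra_simps)
    then show ?case using add by (simp add: lcov.add)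
  next
    case (scale F v)
    have "(\<lambda>z g. cross (cross (l z g) (l' z g)) (F z g *s v z g)) =
      (\<lambda>z g. F z g *s cross (cross (l z g) (l' z g)) (v z g))"
      by (intro ext) (simp add: vec3_simps algebra_simps)
    then show ?case using scale by (simp add: lcov.scale)
  qed
  show ?thesis using assms(1)
  proof induction
    case zero
    have "(\<lambda>z g. cross 0 (v' z g)) = (\<lambda>z g. 0)" by (intro ext) (simp add: vec3_simps)
    then show ?case by (simp add: lcov.zero)
  next
    case (col i)
    then show ?case using assms(2) by (rule col_left)
  next
    case (cross l l')
    then show ?case using assms(2) by (rule cross_left)
  next
    case (add v w)
    have "(\<lambda>z g. cross (v z g + w z g) (v' z g)) =
      (\<lambda>z g. cross (v z g) (v' z g) + cross (w z g) (v' z g))"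
      by (intro ext) (simp add: vec3_simps algebra_simps)
    then show ?case using add by (simp add: lcov.add)
  next
    case (scale F v)
    have "(\<lambda>z g. cross (F z g *s v z g) (v' z g)) = (\<lambda>z g. F z g *s cross (v z g) (v' z g))"
      by (intro ext) (simp add: vec3_simps algebra_simps)
    then show ?case using scale by (simp add: lcov.scale)
  qed
qed

lemma scov_diff: "F \<in> scov n \<Longrightarrow> F' \<in> scov n \<Longrightarrow> (\<lambda>z g. F z g - F' z g) \<in> scov n"
  using scov.add[OF _ scov.mult[OF scov.const[of "-1"]], of F n F'] by simp

text \<open>Serves the divergence of \<open>F *s w\<close>, which contains the pairing of
  \<open>grad F\<close> with \<open>w\<close>. Linearity in each argument leaves only the
  generators.\<close>

lemma scalar_product_scov:
  assumes "v \<in> vcov n" "w \<in> lcov n"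
  shows "(\<lambda>z g. scalar_product (v z g) (w z g)) \<in> scov n"
proof -
  have lin: "(\<lambda>z g. scalar_product (v z g) (w z g)) \<in> scov n"
    if cov: "\<And>l. l \<in> covecs n \<Longrightarrow> (\<lambda>z g. scalar_product (v z g) (l z g)) \<in> scov n"
      and cr: "\<And>i j. i \<in> {1..n} \<Longrightarrow> j \<in> {1..n} \<Longrightarrow>
        (\<lambda>z g. scalar_product (v z g) (cross (Acol z i) (Acol z j))) \<in> scov n"
      and w: "w \<in> lcov n" for v w
    using w
  proof induction
    case zero
    then show ?case using scov.const[of 0] by (simp add: vec3_simps)
  next
    case (add w w')
    have "(\<lambda>z g. scalar_product (v z g) (w z g + w' z g)) =
      (\<lambda>z g. scalar_product (v z g) (w z g) + scalar_product (v z g) (w' z g))"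
      by (intro ext) (simp add: vec3_simps algebra_simps)
    then show ?case using add by (simp add: scov.add)
  next
    case (scale F w)
    have "(\<lambda>z g. scalar_product (v z g) (F z g *s w z g)) =
      (\<lambda>z g. F z g * scalar_product (v z g) (w z g))"
      by (intro ext) (simp add: vec3_simps algebra_simps)
    then show ?case using scale by (simp add: scov.mult)
  qed (use cov cr in auto)
  show ?thesis using assms(1)
  proof induction
    case zero
    then show ?case using scov.const[of 0] by (simp add: vec3_simps)
  next
    case (col i)
    show ?case
    proof (rule lin[OF _ _ assms(2)])
      fix l assume "l \<in> covecs n"
      moreover have "(\<lambda>z g. scalar_product (Acol z i) (l z g)) =
          (\<lambda>z g. scalar_product (l z g) (Acol z i))"
        by (simp add: vec3_simps algebra_simps)
      ultimately show "(\<lambda>z g. scalar_product (Acol z i) (l z g)) \<in> scov n"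
        using col by (simp add: scov.pairing)
    next
      fix j k assume "j \<in> {1..n}" "k \<in> {1..n}"
      then show "(\<lambda>z g. scalar_product (Acol z i) (cross (Acol z j) (Acol z k))) \<in> scov n"
        using col scov.cols[of i n j k] by (simp add: bracket_def)
    qed
  next
    case (cross l l')
    show ?case
    proof (rule lin[OF _ _ assms(2)])
      fix m assume "m \<in> covecs n"
      moreover have "(\<lambda>z g. scalar_product (cross (l z g) (l' z g)) (m z g)) =
          (\<lambda>z g. bracket (l z g) (l' z g) (m z g))"
        by (intro ext) (simp add: vec3_simps algebra_simps)
      ultimately show "(\<lambda>z g. scalar_product (cross (l z g) (l' z g)) (m z g)) \<in> scov n"
        using cross by (simp add: scov.rows)
    next
      fix i j assume ij: "i \<in> {1..n}" "j \<in> {1..n}"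
      \<comment> \<open>Lagrange's identity: a 2 by 2 determinant of pairings.\<close>
      have "(\<lambda>z g. scalar_product (cross (l z g) (l' z g)) (cross (Acol z i) (Acol z j))) =
        (\<lambda>z g. scalar_product (l z g) (Acol z i) * scalar_product (l' z g) (Acol z j) -
          scalar_product (l z g) (Acol z j) * scalar_product (l' z g) (Acol z i))"
        by (intro ext) (simp add: vec3_simps algebra_simps)
      then show "(\<lambda>z g. scalar_product (cross (l z g) (l' z g)) (cross (Acol z i) (Acol z j))) \<in> scov n"
        using cross ij by (auto intro!: scov.intros scov_diff)
    qed
  next
    case (add v v')
    have "(\<lambda>z g. scalar_product (v z g + v' z g) (w z g)) =
      (\<lambda>z g. scalar_product (v z g) (w z g) + scalar_product (v' z g) (w z g))"
      by (intro ext) (simp add: vec3_simps algebra_simps)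
    then show ?case using add by (simp add: scov.add)
  next
    case (scale F v)
    have "(\<lambda>z g. scalar_product (F z g *s v z g) (w z g)) =
      (\<lambda>z g. F z g * scalar_product (v z g) (w z g))"
      by (intro ext) (simp add: vec3_simps algebra_simps)
    then show ?case using scale by (simp add: scov.mult)
  qed
qed

lemma curl_lcov:
  assumes "v \<in> vcov n"
  shows "(\<lambda>z g. curl i (v z) g) \<in> lcov n"
  using assms
proof induction
  case zero
  have "(\<lambda>z g. curl i (\<lambda>g. 0) g) = (\<lambda>(z::point) g. 0)" by (intro ext) (simp add: vec3_simps)
  then show ?case by (simp add: lcov.zero)
next
  case (col j)
  have "(\<lambda>z g. curl i (\<lambda>g. Acol z j) g) = (\<lambda>z g. 0)" by (intro ext) (simp add: vec3_simps)
  then show ?case by (simp add: lcov.zero)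
next
  case (cross l l')
  obtain \<kappa> where \<kappa>: "\<And>a b z g. pd i a (\<lambda>g. l z g $ b) g = (if a = b then \<kappa> else 0)"
    using covecs_pd[OF cross(1)] by metis
  obtain \<kappa>' where \<kappa>': "\<And>a b z g. pd i a (\<lambda>g. l' z g $ b) g = (if a = b then \<kappa>' else 0)"
    using covecs_pd[OF cross(2)] by metis
  \<comment> \<open>For constant \<open>a\<close> the curl of \<open>cross a x\<close> in
    \<open>x\<close> is \<open>2 *s a\<close>; exchanging the factors changes the sign.\<close>
  have eq: "(\<lambda>z g. curl i (\<lambda>g. cross (l z g) (l' z g)) g) =
    (\<lambda>z g. (2 * \<kappa>') *s l z g + (- 2 * \<kappa>) *s l' z g)"
    using cross by (intro ext) (simp add: vec3_simps \<kappa> \<kappa>' algebra_simps)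
  show ?case
    by (simp only: eq) (intro lcov.add lcov_smult lcov.covec cross)
next
  case (add v v')
  have "(\<lambda>z g. curl i (\<lambda>g. v z g + v' z g) g) = (\<lambda>z g. curl i (v z) g + curl i (v' z) g)"
    using add by (intro ext) (simp add: vec3_simps)
  then show ?case using add by (simp add: lcov.add)
next
  case (scale F v)
  have "(\<lambda>z g. curl i (\<lambda>g. F z g *s v z g) g) =
      (\<lambda>z g. F z g *s curl i (v z) g + cross (grad i (F z) g) (v z g))"
    using scale by (intro ext) (simp add: vec3_simps algebra_simps)
  then show ?case using scale by (simp add: lcov.add lcov.scale cross_lcov grad_vcov)
qed

lemma diverg_scov:
  assumes "w \<in> lcov n"
  shows "(\<lambda>z g. diverg i (w z) g) \<in> scov n"
  using assms
proof induction
  case zero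
  then show ?case using scov.const[of 0] by (simp add: diverg_def)
next
  case (covec l)
  obtain \<kappa> where \<kappa>: "\<And>a b z g. pd i a (\<lambda>g. l z g $ b) g = (if a = b then \<kappa> else 0)"
    using covecs_pd[OF covec] by metis
  show ?case using scov.const[of "\<kappa> + \<kappa> + \<kappa>"] by (simp add: diverg_def \<kappa>)
next
  case (cross j k)
  then show ?case using scov.const[of 0] by (simp add: diverg_def)
next
  case (add w w')
  have "(\<lambda>z g. diverg i (\<lambda>g. w z g + w' z g) g) = (\<lambda>z g. diverg i (w z) g + diverg i (w' z) g)"
    using add by (intro ext) (simp add: diverg_def)
  then show ?case using add by (simp add: scov.add)
next
  case (scale F w)
  have "(\<lambda>z g. diverg i (\<lambda>g. F z g *s w z g) g) =
      (\<lambda>z g. F z g * diverg i (w z) g + scalar_product (grad i (F z) g) (w z g))"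
    using scale by (intro ext) (simp add: diverg_def vec3_simps algebra_simps)
  then show ?case using scale by (simp add: scov.add scov.mult scalar_product_scov grad_vcov)
qed

lemma Omega_scov: "F \<in> scov n \<Longrightarrow> (\<lambda>z. Omega (F z)) \<in> scov n"
  unfolding Omega_def using diverg_scov[OF curl_lcov[OF grad_vcov]] by simp

lemma Omega_iterate_scov: "F \<in> scov n \<Longrightarrow> (\<lambda>z. (Omega ^^ k) (F z)) \<in> scov n"
  by (induction k) (simp_all add: Omega_scov)

lemma Omega_iterate_poly_det:
  "(Omega ^^ k) (\<lambda>g. poly q (det g)) = (\<lambda>g. poly ((omega_poly ^^ k) q) (det g))"
  by (induction k) (simp_all add: Omega_poly_det)

section \<open>Generators of the invariants\<close>

lemma MM_I: "z \<in> {1..n} \<rightarrow>\<^sub>E UNIV \<Longrightarrow>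
  (\<And>i. i \<in> {1..n} \<Longrightarrow> scalar_product (lrow z i) (Acol z i) = 0) \<Longrightarrow> z \<in> MM n"
  by (simp add: MM_def)

lemma MM_D: "z \<in> MM n \<Longrightarrow> i \<in> {1..n} \<Longrightarrow> scalar_product (lrow z i) (Acol z i) = 0"
  by (simp add: MM_def)

text \<open>The polynomial extension of the \<open>SL\<^sub>3\<close>-action to all matrices, obtained by replacing \<open>g\<inverse>\<close> by
  the adjugate of \<open>g\<close>, whose columns are cross products of the rows of \<open>g\<close>.\<close>

definition adj_act :: "complex^3 \<Rightarrow> complex^3^3 \<Rightarrow> complex^3" where
  "adj_act l g = vector [bracket l (g$2) (g$3), bracket l (g$3) (g$1), bracket l (g$1) (g$2)]"

definition gact :: "nat \<Rightarrow> complex^3^3 \<Rightarrow> point \<Rightarrow> point" where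
  "gact n g z = (\<lambda>i\<in>{1..n}. (g *v Acol z i, adj_act (lrow z i) g))"

definition lscale :: "nat \<Rightarrow> complex \<Rightarrow> point \<Rightarrow> point" where
  "lscale n d z = (\<lambda>i\<in>{1..n}. (Acol z i, d *s lrow z i))"

lemma adj_act_nth [simp]:
  "adj_act l g $ 1 = bracket l (g$2) (g$3)"
  "adj_act l g $ 2 = bracket l (g$3) (g$1)"
  "adj_act l g $ 3 = bracket l (g$1) (g$2)"
  by (simp_all add: adj_act_def)

lemma matrix_vector_mult_nth: "(g *v a) $ k = scalar_product (g $ k) a"
  by (simp add: matrix_vector_mult_def scalar_product_def)

lemma scalar_product_adj_act:
  "scalar_product (adj_act l g) (g *v a) = det g * scalar_product l a" for a :: "complex^3"
  by (simp add: scalar_product_3 matrix_vector_mult_nth bracket_def det_bracket algebra_simps)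

lemma scalar_product_scale: "scalar_product (d *s l) a = d * scalar_product l a" for a :: "complex^3"
  by (simp add: scalar_product_3 algebra_simps)

lemma gact_MM: "z \<in> MM n \<Longrightarrow> gact n g z \<in> MM n"
  by (rule MM_I) (auto simp: gact_def scalar_product_adj_act MM_D)

lemma lscale_MM: "z \<in> MM n \<Longrightarrow> lscale n d z \<in> MM n"
  by (rule MM_I) (auto simp: lscale_def scalar_product_scale MM_D)

lemma gact_nth: "i \<in> {1..n} \<Longrightarrow> gact n g z i = (g *v Acol z i, adj_act (lrow z i) g)"
  and lscale_nth: "i \<in> {1..n} \<Longrightarrow> lscale n d z i = (Acol z i, d *s lrow z i)"
  by (simp_all add: gact_def lscale_def)

lemma MM_extensional: "z \<in> MM n \<Longrightarrow> (\<lambda>i\<in>{1..n}. z i) = z"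
  by (simp add: MM_def PiE_iff extensional_restrict)

lemma lscale_1 [simp]: "z \<in> MM n \<Longrightarrow> lscale n 1 z = z"
  using MM_extensional[of z n] by (simp add: lscale_def)

text \<open>The coordinates of \<open>g *v A_i\<close> are pairings of \<open>A_i\<close> with rows
  of \<open>g\<close>, those of \<open>adj_act l_i g\<close> are brackets of \<open>l_i\<close> with
  two rows of \<open>g\<close>.\<close>

lemma poly_funs_gact_scov:
  assumes "H \<in> poly_funs n"
  shows "\<exists>F\<in>scov n. \<forall>z\<in>MM n. \<forall>g. H (gact n g z) = F z g"
  using assms
proof induction
  case (const c)
  then show ?case by (intro bexI[of _ "\<lambda>z g. c"]) (auto simp: gact_MM scov.const)
next
  case (col i k)
  then show ?case
    by (intro bexI[of _ "\<lambda>z g. scalar_product (g $ k) (Acol z i)"] scov.pairing covecs.mat)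
      (auto simp: gact_MM gact_nth matrix_vector_mult_nth)
next
  case (row i k)
  have "\<exists>a b. \<forall>l g. adj_act l g $ k = bracket l (g $ a) (g $ b)"
    using exhaust_3[of k] by auto metis+
  then obtain a b where "\<And>l g. adj_act l g $ k = bracket l (g $ a) (g $ b)" by blast
  then show ?case using row
    by (intro bexI[of _ "\<lambda>z g. bracket (lrow z i) (g $ a) (g $ b)"])
       (auto simp: gact_MM gact_nth intro!: scov.rows covecs.intros)
next
  case (add f h)
  then obtain F F' where "F \<in> scov n" "F' \<in> scov n" "\<forall>z\<in>MM n. \<forall>g. f (gact n g z) = F z g"
    "\<forall>z\<in>MM n. \<forall>g. h (gact n g z) = F' z g" by blast
  then show ?case
    by (intro bexI[of _ "\<lambda>z g. F z g + F' z g"]) (auto simp: gact_MM scov.add)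
next
  case (mult f h)
  then obtain F F' where "F \<in> scov n" "F' \<in> scov n" "\<forall>z\<in>MM n. \<forall>g. f (gact n g z) = F z g"
    "\<forall>z\<in>MM n. \<forall>g. h (gact n g z) = F' z g" by blast
  then show ?case
    by (intro bexI[of _ "\<lambda>z g. F z g * F' z g"]) (auto simp: gact_MM scov.mult)
qed

text \<open>The bound \<open>N\<close> is uniform in \<open>z\<close>, so that the expansion of
  \<open>H\<close> in \<open>WW_scov\<close> has a fixed number of terms.\<close>

lemma poly_funs_lscale:
  assumes "H \<in> poly_funs n"
  shows "\<exists>q N. \<forall>z\<in>MM n. degree (q z) \<le> N \<and> (\<forall>d. H (lscale n d z) = poly (q z) d)"
  using assms
proof induction
  case (const c)
  then show ?case by (intro exI[of _ "\<lambda>z. [:c:]"] exI[of _ 0]) (auto simp: lscale_MM)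
next
  case (col i k)
  then show ?case
    by (intro exI[of _ "\<lambda>z. [:Acol z i $ k:]"] exI[of _ 0]) (auto simp: lscale_MM lscale_nth)
next
  case (row i k)
  then show ?case
    by (intro exI[of _ "\<lambda>z. [:0, lrow z i $ k:]"] exI[of _ 1]) (auto simp: lscale_MM lscale_nth)
next
  case (add f h)
  then obtain q N q' N' where
    "\<forall>z\<in>MM n. degree (q z) \<le> N \<and> (\<forall>d. f (lscale n d z) = poly (q z) d)"
    "\<forall>z\<in>MM n. degree (q' z) \<le> N' \<and> (\<forall>d. h (lscale n d z) = poly (q' z) d)" by blast
  then show ?case
    by (intro exI[of _ "\<lambda>z. q z + q' z"] exI[of _ "max N N'"])
      (auto simp: lscale_MM intro!: degree_add_le)
next
  case (mult f h)
  then obtain q N q' N' where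
    "\<forall>z\<in>MM n. degree (q z) \<le> N \<and> (\<forall>d. f (lscale n d z) = poly (q z) d)"
    "\<forall>z\<in>MM n. degree (q' z) \<le> N' \<and> (\<forall>d. h (lscale n d z) = poly (q' z) d)" by blast
  then show ?case
    by (intro exI[of _ "\<lambda>z. q z * q' z"] exI[of _ "N + N'"])
      (auto simp: lscale_MM intro!: order_trans[OF degree_mult_le] add_mono)
qed

lemma adj_act_vmult: "adj_act l g v* g = det g *s l"
  by (simp add: vec3_simps vector_matrix_mult_def sum_3 det_bracket algebra_simps)

lemma matrix_inv_adj:
  fixes G :: "complex^3^3"
  assumes "det G = 1"
  shows "l v* matrix_inv G = adj_act l G"
proof -
  have inv: "invertible G" using assms by (simp add: invertible_det_nz)
  have "adj_act l G v* G = l"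
    using assms by (simp add: adj_act_vmult)
  then have "l v* matrix_inv G = adj_act l G v* (G ** matrix_inv G)"
    by (metis vector_matrix_mul_assoc)
  moreover have "G ** matrix_inv G = mat 1"
    using someI_ex[OF inv[unfolded invertible_def]] by (simp add: matrix_inv_def)
  ultimately show ?thesis by simp
qed

text \<open>Here \<open>c\<close> is a cube root of \<open>det g\<close>: up to the torus action by the constant \<open>c\<close>, the matrix \<open>g\<close>
  acts as \<open>g / c \<in> SL\<^sub>3\<close> on the rescaled point.\<close>

lemma WW_gact:
  assumes H: "H \<in> carrier (WW n)" and z: "z \<in> MM n" and g: "det g \<noteq> 0"
  shows "det g ^ n * H (gact n g z) = H (lscale n (det g) z)"
proof -
  obtain c where c: "c ^ 3 = det g"
    by (metis exists_complex_root zero_neq_numeral)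
  have c0: "c \<noteq> 0" using g by (simp flip: c)
  define G where "G = (\<chi> i. (1 / c) *s (g $ i))"
  have g_nth: "g $ i $ j = c * G $ i $ j" for i j using c0 by (simp add: G_def)
  have "det g = c ^ 3 * det G"
    by (simp add: det_bracket vec3_simps g_nth power3_eq_cube algebra_simps)
  with c g have detG: "det G = 1" by simp
  define t where "t = (\<lambda>i\<in>{1..n}. c)"
  have t: "t \<in> torus n" by (auto simp: t_def torus_def c0)
  let ?y = "lscale n (det g) z"
  have y: "?y \<in> MM n" using z by (rule lscale_MM)
  have sl: "sl3_act n G ?y = (\<lambda>i\<in>{1..n}. (G *v Acol ?y i, adj_act (lrow ?y i) G))"
    by (simp add: sl3_act_def matrix_inv_adj[OF detG])
  have sl': "sl3_act n G ?y = gact n G ?y"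
    by (simp add: sl gact_def)
  have A: "c *s (G *v a) = g *v a" for a
    by (simp add: vec3_simps matrix_vector_mult_nth g_nth algebra_simps)
  \<comment> \<open>\<open>adj_act\<close> is linear in the row and quadratic in the matrix, so both
    sides equal \<open>(c * c) *s adj_act l G\<close>.\<close>
  have l: "inverse c *s adj_act (det g *s l) G = adj_act l g" for l
  proof -
    have "adj_act (det g *s l) G = det g *s adj_act l G"
      by (simp add: vec_eq_iff forall_3 bracket_def scalar_product_scale)
    moreover have "adj_act l g = (c * c) *s adj_act l G"
      by (simp add: vec3_simps g_nth algebra_simps)
    moreover have "inverse c * det g = c * c"
      using c0 by (simp add: c[symmetric] power3_eq_cube)
    ultimately show ?thesis by simp
  qed
  have "gact n g z = torus_act n t (sl3_act n G ?y)"
  proof (rule ext)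
    fix i
    show "gact n g z i = torus_act n t (sl3_act n G ?y) i"
    proof (cases "i \<in> {1..n}")
      case True
      then show ?thesis
        by (simp add: sl' gact_nth lscale_nth torus_act_def t_def A l del: atLeastAtMost_iff)
    next
      case False
      then show ?thesis by (auto simp: gact_def torus_act_def)
    qed
  qed
  then have "H (gact n g z) = (\<Prod>i\<in>{1..n}. t i) powi (-3) * H (sl3_act n G ?y)"
    using H t gact_MM[OF y, of G] by (auto simp: WW_def torus_weight_m3_def sl')
  also have "(\<Prod>i\<in>{1..n}. t i) = c ^ n" by (simp add: t_def)
  also have "H (sl3_act n G ?y) = H ?y"
    using H y detG by (auto simp: WW_def sl3_invariant_def sl3_def)
  finally have "H (gact n g z) = (c ^ n) powi (-3) * H ?y" .
  \<comment> \<open>The cube root and the weight -3 match: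
    \<open>(c ^ n) ^ 3 = det g ^ n\<close>.\<close>
  moreover have "(c ^ n) powi (-3) * det g ^ n = 1"
  proof -
    have "det g ^ n = (c ^ n) ^ 3" by (simp add: mult.commute flip: c power_mult)
    then show ?thesis using c0 by (simp add: power_int_minus)
  qed
  ultimately show ?thesis by (metis mult.assoc mult.commute mult_1)
qed

section \<open>Extracting \<open>H\<close> by the Omega process\<close>

lemma scov_power: "F \<in> scov n \<Longrightarrow> (\<lambda>z g. F z g ^ k) \<in> scov n"
proof (induction k)
  case 0
  then show ?case using scov.const[of 1] by simp
next
  case (Suc k)
  then show ?case using scov.mult by fastforce
qed

lemma scov_sum: "(\<And>k. k \<in> S \<Longrightarrow> F k \<in> scov n) \<Longrightarrow> (\<lambda>z g. \<Sum>k\<in>S. F k z g) \<in> scov n"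
proof (induction S rule: infinite_finite_induct)
  case (insert x S)
  then have "(\<lambda>z g. F x z g + (\<Sum>k\<in>S. F k z g)) \<in> scov n" by (intro scov.add) auto
  with insert show ?case by simp
qed (use scov.const[of 0] in auto)

lemma scov_det: "(\<lambda>z. det) \<in> scov n"
proof -
  have "(\<lambda>z::point. det) = (\<lambda>z g. bracket (g$1) (g$2) (g$3))"
    by (intro ext) (simp add: det_bracket)
  then show ?thesis by (simp add: scov.rows covecs.mat)
qed

lemma WW_scov:
  assumes H: "H \<in> carrier (WW n)"
  obtains F where "F \<in> scov n" "\<And>z. z \<in> MM n \<Longrightarrow> H z = F z 0"
proof -
  have Hp: "H \<in> poly_funs n" using H by (simp add: WW_def)
  obtain F where F: "F \<in> scov n" "\<And>z g. z \<in> MM n \<Longrightarrow> H (gact n g z) = F z g"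
    using poly_funs_gact_scov[OF Hp] by blast
  obtain q N where q: "\<And>z. z \<in> MM n \<Longrightarrow> degree (q z) \<le> N"
      "\<And>z d. z \<in> MM n \<Longrightarrow> H (lscale n d z) = poly (q z) d"
    using poly_funs_lscale[OF Hp] by blast
  \<comment> \<open>The additional factor \<open>det g\<close> makes the identity hold for singular \<open>g\<close> as well.\<close>
  define F1 where "F1 = (\<lambda>z g. det g ^ Suc n * F z g)"
  have F1: "F1 \<in> scov n"
    unfolding F1_def using F(1) by (intro scov.mult scov_power scov_det)
  have F1_eq: "F1 z = (\<lambda>g. poly (pCons 0 (q z)) (det g))" if z: "z \<in> MM n" for z
  proof
    fix g
    show "F1 z g = poly (pCons 0 (q z)) (det g)"
      using WW_gact[OF H z, of g] F(2)[OF z] q(2)[OF z]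
      by (cases "det g = 0") (auto simp: F1_def)
  qed
  \<comment> \<open>\<open>F1\<close> carries the extra factor \<open>det g\<close>, so coefficient
    \<open>p\<close> of \<open>q z\<close> sits in degree \<open>Suc p\<close>; after
    \<open>Suc p\<close> applications it is, up to \<open>c\<close>, the constant term, which is
    read off at \<open>g = 0\<close>.\<close>
  have "\<exists>F'\<in>scov n. \<forall>z\<in>MM n. coeff (q z) p = F' z 0" for p
  proof -
    obtain c where c: "c \<noteq> 0" "\<And>q. coeff ((omega_poly ^^ Suc p) q) 0 = c * coeff q (Suc p)"
      using coeff_omega_poly_iterate[of "Suc p"] by blast
    have "c * coeff (q z) p = (Omega ^^ Suc p) (F1 z) 0" if "z \<in> MM n" for z
    proof -
      have "(Omega ^^ Suc p) (F1 z) 0 = poly ((omega_poly ^^ Suc p) (pCons 0 (q z))) (det (0::complex^3^3))"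
        by (simp only: F1_eq[OF that] Omega_iterate_poly_det)
      also have "det (0::complex^3^3) = 0" by (simp add: det_3)
      finally show ?thesis using c(2)[of "pCons 0 (q z)"] by (simp add: poly_0_coeff_0)
    qed
    then have "\<forall>z\<in>MM n. coeff (q z) p = inverse c * (Omega ^^ Suc p) (F1 z) 0"
      using c(1) by (simp add: field_simps)
    then show ?thesis
      by (intro bexI[OF _ scov.mult[OF scov.const Omega_iterate_scov[OF F1]]])
  qed
  then obtain F' where F': "\<And>p. F' p \<in> scov n" "\<And>p z. z \<in> MM n \<Longrightarrow> coeff (q z) p = F' p z 0"
    by metis
  have "H z = (\<Sum>p\<le>N. F' p z 0)" if "z \<in> MM n" for z
  proof -
    \<comment> \<open>The factor 1 rescales nothing, so \<open>H z\<close> is the sum of all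
      coefficients.\<close>
    have "H z = poly (q z) 1" using q(2)[OF that, of 1] that by simp
    also have "\<dots> = (\<Sum>p\<le>degree (q z). coeff (q z) p)"
      by (simp add: poly_altdef)
    also have "\<dots> = (\<Sum>p\<le>N. coeff (q z) p)"
      using q(1)[OF that] by (intro sum.mono_neutral_left) (auto simp: coeff_eq_0)
    finally show ?thesis using F'(2)[OF that] by simp
  qed
  then show ?thesis using scov_sum[of "{..N}" F' n, OF F'(1)] by (intro that) auto
qed

section \<open>Weights of monomials\<close>

text \<open>Formal symbols, since weights are read off a monomial and not off the function it
  defines, which satisfies relations. \<open>SE\<close> stands for the brackets of columns; indices
  may come in any order and repeat.\<close>

datatype sym = SC nat nat | SD nat nat nat | SE nat nat nat

fun sev :: "sym \<Rightarrow> point \<Rightarrow> complex" where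
  "sev (SC i j) z = CC i j z"
| "sev (SD i j k) z = bracket (lrow z i) (lrow z j) (lrow z k)"
| "sev (SE i j k) z = bracket (Acol z i) (Acol z j) (Acol z k)"

fun indices :: "sym \<Rightarrow> nat set" where
  "indices (SC i j) = {i, j}"
| "indices (SD i j k) = {i, j, k}"
| "indices (SE i j k) = {i, j, k}"

text \<open>The exponent of \<open>t_l\<close> that the symbol acquires under the torus; the
  contributions of repeated indices add up.\<close>

fun swt :: "sym \<Rightarrow> nat \<Rightarrow> int" where
  "swt (SC i j) l = of_bool (l = j) - of_bool (l = i)"
| "swt (SD i j k) l = - of_bool (l = i) - of_bool (l = j) - of_bool (l = k)"
| "swt (SE i j k) l = of_bool (l = i) + of_bool (l = j) + of_bool (l = k)"

definition mev :: "sym multiset \<Rightarrow> point \<Rightarrow> complex" where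
  "mev m z = (\<Prod>s\<in>#m. sev s z)"

definition mwt :: "sym multiset \<Rightarrow> nat \<Rightarrow> int" where
  "mwt m i = (\<Sum>s\<in>#m. swt s i)"

definition monomials :: "nat \<Rightarrow> sym multiset set" where
  "monomials n = {m. \<forall>s\<in>#m. indices s \<subseteq> {1..n}}"

lemma mev_simps [simp]:
  "mev {#} z = 1" "mev (add_mset s m) z = sev s z * mev m z" "mev (m + m') z = mev m z * mev m' z"
  by (simp_all add: mev_def)

lemma mwt_simps [simp]:
  "mwt {#} i = 0" "mwt (add_mset s m) i = swt s i + mwt m i" "mwt (m + m') i = mwt m i + mwt m' i"
  by (simp_all add: mwt_def)

lemma monomials_simps [simp]:
  "{#} \<in> monomials n" "add_mset s m \<in> monomials n \<longleftrightarrow> indices s \<subseteq> {1..n} \<and> m \<in> monomials n"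
  "m + m' \<in> monomials n \<longleftrightarrow> m \<in> monomials n \<and> m' \<in> monomials n"
  by (auto simp: monomials_def)

text \<open>A list of terms, in which a monomial may recur: sums become appends, and passing to a
  weight component becomes a filter.\<close>

definition lincomb :: "(complex \<times> sym multiset) list \<Rightarrow> point \<Rightarrow> complex" where
  "lincomb xs z = (\<Sum>(c, m)\<leftarrow>xs. c * mev m z)"

lemma lincomb_simps [simp]:
  "lincomb [] z = 0" "lincomb ((c, m) # xs) z = c * mev m z + lincomb xs z"
  "lincomb (xs @ ys) z = lincomb xs z + lincomb ys z"
  by (simp_all add: lincomb_def)

lemma lincomb_mult:
  "lincomb (concat (map (\<lambda>(c, m). map (\<lambda>(c', m'). (c * c', m + m')) ys) xs)) z
    = lincomb xs z * lincomb ys z"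
proof (induction xs)
  case (Cons x xs)
  obtain c m where x: "x = (c, m)" by force
  have "lincomb (map (\<lambda>(c', m'). (c * c', m + m')) ys) z = c * mev m z * lincomb ys z"
    by (induction ys) (auto simp: algebra_simps)
  with Cons show ?case by (simp add: x algebra_simps)
qed simp

lemma covecs_cases:
  "l \<in> covecs n \<Longrightarrow> (\<exists>i\<in>{1..n}. l = (\<lambda>z g. lrow z i)) \<or> (\<exists>w. l = (\<lambda>z g. g $ w))"
  by (erule covecs.cases) blast+

text \<open>At \<open>g = 0\<close> each pairing or bracket that contains a row of \<open>g\<close>
  vanishes, which leaves the symbols in the \<open>l_i\<close> and \<open>A_i\<close>.\<close>

lemma scov_lincomb:
  assumes "F \<in> scov n"
  shows "\<exists>xs. snd ` set xs \<subseteq> monomials n \<and> (\<forall>z. F z 0 = lincomb xs z)"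
  using assms
proof induction
  case (const c)
  then show ?case by (intro exI[of _ "[(c, {#})]"]) auto
next
  case (pairing l i)
  from pairing(1) show ?case
  proof cases
    case (row j)
    with pairing show ?thesis by (intro exI[of _ "[(1, {#SC j i#})]"]) (auto simp: CC_def)
  next
    case (mat w)
    then show ?thesis by (intro exI[of _ "[]"]) (auto simp: scalar_product_3)
  qed
next
  case (rows l1 l2 l3)
  show ?case
  proof (cases "\<exists>i j k. {i, j, k} \<subseteq> {1..n} \<and> l1 = (\<lambda>z g. lrow z i) \<and> l2 = (\<lambda>z g. lrow z j) \<and>
      l3 = (\<lambda>z g. lrow z k)")
    case True
    then obtain i j k where "{i, j, k} \<subseteq> {1..n}" "l1 = (\<lambda>z g. lrow z i)" "l2 = (\<lambda>z g. lrow z j)"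
      "l3 = (\<lambda>z g. lrow z k)" by blast
    then show ?thesis by (intro exI[of _ "[(1, {#SD i j k#})]"]) auto
  next
    case False
    with rows have "(\<exists>w. l1 = (\<lambda>z g. g $ w)) \<or> (\<exists>w. l2 = (\<lambda>z g. g $ w)) \<or> (\<exists>w. l3 = (\<lambda>z g. g $ w))"
      using rows[THEN covecs_cases] by blast
    then have "bracket (l1 z 0) (l2 z 0) (l3 z 0) = 0" for z by (auto simp: vec3_simps)
    then show ?thesis by (intro exI[of _ "[]"]) auto
  qed
next
  case (cols i j k)
  then show ?case by (intro exI[of _ "[(1, {#SE i j k#})]"]) auto
next
  case (add F F')
  then obtain xs ys where "snd ` set xs \<subseteq> monomials n" "\<forall>z. F z 0 = lincomb xs z"
    "snd ` set ys \<subseteq> monomials n" "\<forall>z. F' z 0 = lincomb ys z" by blast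
  then show ?case by (intro exI[of _ "xs @ ys"]) auto
next
  case (mult F F')
  then obtain xs ys where xs: "snd ` set xs \<subseteq> monomials n" "\<forall>z. F z 0 = lincomb xs z"
    and ys: "snd ` set ys \<subseteq> monomials n" "\<forall>z. F' z 0 = lincomb ys z" by blast
  let ?zs = "concat (map (\<lambda>(c, m). map (\<lambda>(c', m'). (c * c', m + m')) ys) xs)"
  have "snd ` set ?zs \<subseteq> monomials n"
    using xs(1) ys(1) by (fastforce simp: image_subset_iff)
  then show ?case
    using xs(2) ys(2) by (intro exI[of _ ?zs]) (simp add: lincomb_mult)
qed

section \<open>Isolating the torus weight\<close>

lemma torus_act_nth: "i \<in> {1..n} \<Longrightarrow> torus_act n t z i = (t i *s Acol z i, inverse (t i) *s lrow z i)"
  by (simp add: torus_act_def)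

lemma scalar_product_scale2: "scalar_product (c *s l) (d *s a) = c * d * scalar_product l a"
  and bracket_scale: "bracket (c *s l) (d *s a) (e *s b) = c * d * e * bracket l a b"
  for l a b :: "complex^3"
  by (simp_all add: scalar_product_3 bracket_def algebra_simps)

lemma torus_act_MM: "z \<in> MM n \<Longrightarrow> torus_act n t z \<in> MM n"
proof (rule MM_I)
  fix i assume "z \<in> MM n" and i: "i \<in> {1..n}"
  then have "scalar_product (lrow z i) (Acol z i) = 0" by (simp add: MM_D)
  then show "scalar_product (lrow (torus_act n t z) i) (Acol (torus_act n t z) i) = 0"
    by (simp add: torus_act_nth[OF i] scalar_product_scale2)
qed (simp add: torus_act_def)

text \<open>A one-parameter subgroup that moves only index \<open>i\<close>, so that weights are
  isolated index by index.\<close>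

definition torus_at :: "nat \<Rightarrow> nat \<Rightarrow> complex \<Rightarrow> nat \<Rightarrow> complex" where
  "torus_at n i x = (\<lambda>j\<in>{1..n}. if j = i then x else 1)"

lemma torus_at: "x \<noteq> 0 \<Longrightarrow> torus_at n i x \<in> torus n"
  by (auto simp: torus_at_def torus_def)

lemma sev_torus_at:
  assumes "x \<noteq> 0" "indices s \<subseteq> {1..n}"
  shows "sev s (torus_act n (torus_at n i x) z) = x powi swt s i * sev s z"
proof (cases s)
  case (SC j k)
  define c where "c p = (if i = p then inverse x else 1)" for p
  define d where "d p = (if i = p then x else 1)" for p
  have act: "lrow (torus_act n (torus_at n i x) z) p = c p *s lrow z p"
    "Acol (torus_act n (torus_at n i x) z) p = d p *s Acol z p" if "p \<in> {1..n}" for p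
    using that by (simp_all add: torus_act_def torus_at_def c_def d_def)
  \<comment> \<open>Integer powers treat coinciding and distinct indices alike.\<close>
  have cd: "c p = x powi (- of_bool (i = p))" "d p = x powi (of_bool (i = p))" for p
    using assms(1) by (simp_all add: c_def d_def power_int_minus)
  have "sev s (torus_act n (torus_at n i x) z) = d k * c j * sev s z"
    using assms SC by (simp add: act CC_def scalar_product_scale2)
  also have "d k * c j = x powi swt s i"
    using assms(1) by (simp add: cd SC flip: power_int_add)
  finally show ?thesis .
next
  case (SD j k l)
  define c where "c p = (if i = p then inverse x else 1)" for p
  have act: "lrow (torus_act n (torus_at n i x) z) p = c p *s lrow z p" if "p \<in> {1..n}" for p
    using that by (simp add: torus_act_def torus_at_def c_def)
  have c: "c p = x powi (- of_bool (i = p))" for p using assms(1) by (simp add: c_def power_int_minus)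
  have "sev s (torus_act n (torus_at n i x) z) = c j * c k * c l * sev s z"
    using assms SD by (simp add: act bracket_scale)
  also have "c j * c k * c l = x powi swt s i"
    using assms(1) by (simp add: c SD flip: power_int_add)
  finally show ?thesis .
next
  case (SE j k l)
  define c where "c p = (if i = p then x else 1)" for p
  have act: "Acol (torus_act n (torus_at n i x) z) p = c p *s Acol z p" if "p \<in> {1..n}" for p
    using that by (simp add: torus_act_def torus_at_def c_def)
  have c: "c p = x powi (of_bool (i = p))" for p using assms(1) by (simp add: c_def)
  have "sev s (torus_act n (torus_at n i x) z) = c j * c k * c l * sev s z"
    using assms SE by (simp add: act bracket_scale)
  also have "c j * c k * c l = x powi swt s i"
    using assms(1) by (simp add: c SE flip: power_int_add)
  finally show ?thesis .
qed

lemma mev_torus_at: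
  assumes "x \<noteq> 0" "m \<in> monomials n"
  shows "mev m (torus_act n (torus_at n i x) z) = x powi mwt m i * mev m z"
  using assms(2) by (induction m) (simp_all add: sev_torus_at assms(1) power_int_add)

text \<open>A power of \<open>x\<close> clears the negative exponents; what remains is a polynomial
  with infinitely many zeros. Exponents may recur in the list, hence the sum over all terms with
  exponent \<open>d\<close>.\<close>

lemma Laurent_coeff_eq_0:
  fixes xs :: "(complex \<times> int) list"
  assumes "\<And>x. x \<noteq> 0 \<Longrightarrow> (\<Sum>(c, e)\<leftarrow>xs. c * x powi e) = 0"
  shows "(\<Sum>(c, e)\<leftarrow>xs. if e = d then c else 0) = 0"
proof -
  obtain K :: int where K: "\<And>c e. (c, e) \<in> set xs \<Longrightarrow> 0 \<le> e + K" and Kd: "0 \<le> d + K"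
  proof
    \<comment> \<open>The sum of all absolute values is a crude shift that serves every exponent and
      \<open>d\<close> itself.\<close>
    let ?K = "\<bar>d\<bar> + (\<Sum>(c, e)\<leftarrow>xs. \<bar>e\<bar>)"
    fix c e assume "(c, e) \<in> set xs"
    then have "\<bar>e\<bar> \<le> (\<Sum>(c, e)\<leftarrow>xs. \<bar>e\<bar>)"
      by (intro member_le_sum_list) (auto intro!: image_eqI[of _ _ "(c, e)"])
    then show "0 \<le> e + ?K" by linarith
  next
    have "0 \<le> (\<Sum>(c :: complex, e)\<leftarrow>xs. \<bar>e\<bar>)" by (rule sum_list_nonneg) auto
    then show "0 \<le> d + (\<bar>d\<bar> + (\<Sum>(c, e)\<leftarrow>xs. \<bar>e\<bar>))" by linarith
  qed
  define p where "p = (\<Sum>(c, e)\<leftarrow>xs. monom c (nat (e + K)))"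
  have p0: "poly p x = 0" if x: "x \<noteq> 0" for x
  proof -
    have "poly p x = x powi K * (\<Sum>(c, e)\<leftarrow>xs. c * x powi e)"
      unfolding p_def using K
    proof (induction xs)
      case (Cons y xs)
      obtain c e where y: "y = (c, e)" by force
      have "0 \<le> e + K" using Cons.prems y by auto
      then have "x ^ nat (e + K) = x powi (e + K)" by (simp add: power_int_def)
      then show ?case using Cons.IH[OF Cons.prems[OF list.set_intros(2)]] x
        by (simp add: y poly_monom power_int_add algebra_simps)
    qed simp
    with assms[OF x] show ?thesis by simp
  qed
  \<comment> \<open>The factor \<open>x\<close> makes the product vanish at 0 as well.\<close>
  have "poly (p * [:0, 1:]) x = 0" for x using p0[of x] by (cases "x = 0") auto
  then have "p * [:0, 1:] = 0" using poly_all_0_iff_0 by blast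
  then have "p = 0" by simp
  then have "coeff p (nat (d + K)) = 0" by simp
  moreover have "coeff p (nat (d + K)) = (\<Sum>(c, e)\<leftarrow>xs. if e = d then c else 0)"
    unfolding p_def using K
  proof (induction xs)
    case (Cons y xs)
    obtain c e where y: "y = (c, e)" by force
    have "0 \<le> e + K" using Cons.prems y by auto
    then have "nat (e + K) = nat (d + K) \<longleftrightarrow> e = d" using Kd by auto
    then show ?case using Cons.IH[OF Cons.prems[OF list.set_intros(2)]] by (simp add: y)
  qed simp
  ultimately show ?thesis by simp
qed

lemma WW_torus_at:
  assumes H: "H \<in> carrier (WW n)" and z: "z \<in> MM n" and x: "x \<noteq> 0" and i: "i \<in> {1..n}"
  shows "H (torus_act n (torus_at n i x) z) = x powi (-3) * H z"
proof -
  have "(\<Prod>j\<in>{1..n}. torus_at n i x j) = x"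
    using i by (simp add: torus_at_def prod.delta)
  moreover have "H (torus_act n (torus_at n i x) z) =
      (\<Prod>j\<in>{1..n}. torus_at n i x j) powi (-3) * H z"
    using H z torus_at[OF x] unfolding WW_def torus_weight_m3_def by auto
  ultimately show ?thesis by simp
qed

text \<open>For fixed \<open>z\<close> the covariance of \<open>H\<close> under
  \<open>torus_at n i x\<close> is an identity of Laurent polynomials in \<open>x\<close>; the
  coefficients at exponent -3 are compared.\<close>

lemma lincomb_filter_weight:
  assumes H: "H \<in> carrier (WW n)" and xs: "snd ` set xs \<subseteq> monomials n"
    and eq: "\<And>z. z \<in> MM n \<Longrightarrow> H z = lincomb xs z" and z: "z \<in> MM n" and i: "i \<in> {1..n}"
  shows "H z = lincomb (filter (\<lambda>(c, m). mwt m i = -3) xs) z"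
proof -
  \<comment> \<open>The first entry carries \<open>x powi (-3) * H z\<close> to the other side of
    the equation.\<close>
  let ?ys = "(- H z, -3) # map (\<lambda>(c, m). (c * mev m z, mwt m i)) xs"
  have "(\<Sum>(c, e)\<leftarrow>?ys. c * x powi e) = 0" if x: "x \<noteq> 0" for x
  proof -
    have "(\<Sum>(c, e)\<leftarrow>map (\<lambda>(c, m). (c * mev m z, mwt m i)) xs. c * x powi e)
        = lincomb xs (torus_act n (torus_at n i x) z)"
      using xs by (induction xs) (auto simp: mev_torus_at[OF x] algebra_simps)
    also have "\<dots> = x powi (-3) * H z"
      using eq[OF torus_act_MM[OF z]] WW_torus_at[OF H z x i] by metis
    finally show ?thesis by (simp add: algebra_simps)
  qed
  from Laurent_coeff_eq_0[OF this, of "-3"]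
  have "H z = (\<Sum>(c, e)\<leftarrow>map (\<lambda>(c, m). (c * mev m z, mwt m i)) xs. if e = -3 then c else 0)"
    by (simp add: eq_neg_iff_add_eq_0[symmetric])
  also have "\<dots> = lincomb (filter (\<lambda>(c, m). mwt m i = -3) xs) z"
    by (induction xs) auto
  finally show ?thesis .
qed

definition weight_m3 :: "nat \<Rightarrow> sym multiset set" where
  "weight_m3 n = {m \<in> monomials n. \<forall>i\<in>{1..n}. mwt m i = -3}"

lemma WW_lincomb:
  assumes H: "H \<in> carrier (WW n)"
  obtains xs where "snd ` set xs \<subseteq> weight_m3 n" "\<And>z. z \<in> MM n \<Longrightarrow> H z = lincomb xs z"
proof -
  \<comment> \<open>\<open>S\<close> is the set of indices whose weight is already -3 in every term;
    each step filters by one more index.\<close>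
  have "\<exists>xs. snd ` set xs \<subseteq> {m \<in> monomials n. \<forall>i\<in>S. mwt m i = -3} \<and>
      (\<forall>z\<in>MM n. H z = lincomb xs z)" if "S \<subseteq> {1..n}" for S
    using finite_subset[OF that finite_atLeastAtMost] that
  proof (induction S rule: finite_induct)
    case empty
    obtain F where F: "F \<in> scov n" "\<And>z. z \<in> MM n \<Longrightarrow> H z = F z 0"
      using WW_scov[OF H] by blast
    obtain xs where "snd ` set xs \<subseteq> monomials n" "\<And>z. F z 0 = lincomb xs z"
      using scov_lincomb[OF F(1)] by blast
    with F(2) show ?case by (intro exI[of _ xs]) auto
  next
    case (insert i S)
    then obtain xs where xs: "snd ` set xs \<subseteq> {m \<in> monomials n. \<forall>i\<in>S. mwt m i = -3}"
        "\<And>z. z \<in> MM n \<Longrightarrow> H z = lincomb xs z" by auto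
    have "\<forall>z\<in>MM n. H z = lincomb (filter (\<lambda>(c, m). mwt m i = -3) xs) z"
      using insert.prems xs by (intro ballI lincomb_filter_weight[OF H]) auto
    then show ?case
      using xs(1) by (intro exI[of _ "filter (\<lambda>(c, m). mwt m i = -3) xs"]) auto
  qed
  from this[of "{1..n}"] show ?thesis using that by (auto simp: weight_m3_def)
qed

section \<open>The products of \<open>C\<close> and \<open>D\<close>\<close>

lemma pfun_restrict: "f \<in> poly_funs n \<Longrightarrow> (\<lambda>z\<in>MM n. f z) = f"
  by (induction rule: poly_funs.induct) auto

lemma pfun_add: "(\<lambda>z\<in>MM n. f z) \<in> poly_funs n \<Longrightarrow> (\<lambda>z\<in>MM n. h z) \<in> poly_funs n \<Longrightarrow>
    (\<lambda>z\<in>MM n. f z + h z) \<in> poly_funs n"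
  and pfun_mult: "(\<lambda>z\<in>MM n. f z) \<in> poly_funs n \<Longrightarrow> (\<lambda>z\<in>MM n. h z) \<in> poly_funs n \<Longrightarrow>
    (\<lambda>z\<in>MM n. f z * h z) \<in> poly_funs n"
  using poly_funs.add[of "\<lambda>z\<in>MM n. f z" n "\<lambda>z\<in>MM n. h z"]
    poly_funs.mult[of "\<lambda>z\<in>MM n. f z" n "\<lambda>z\<in>MM n. h z"]
  by (simp_all cong: restrict_cong)

lemma pfun_diff: "(\<lambda>z\<in>MM n. f z) \<in> poly_funs n \<Longrightarrow> (\<lambda>z\<in>MM n. h z) \<in> poly_funs n \<Longrightarrow>
    (\<lambda>z\<in>MM n. f z - h z) \<in> poly_funs n"
  using pfun_add[where f = f and h = "\<lambda>z. - 1 * h z"] pfun_mult[OF poly_funs.const[of "-1"]]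
  by simp

section \<open>Determinants of triples of rows\<close>

lemma triplesE:
  assumes "I \<in> triples n"
  obtains p q r where "p < q" "q < r" "I = {p, q, r}" "{p, q, r} \<subseteq> {1..n}"
proof -
  have I: "I \<subseteq> {1..n}" "card I = 3" using assms by (auto simp: triples_def)
  define xs where "xs = sorted_list_of_set I"
  have fin: "finite I" using I(1) finite_subset by blast
  have xs: "sorted xs" "distinct xs" "set xs = I" "length xs = 3"
    using fin I(2) by (simp_all add: xs_def)
  then obtain p q r where "xs = [p, q, r]"
    by (metis length_Suc_conv length_0_conv numeral_3_eq_3)
  with xs I show ?thesis by (intro that[of p q r]) auto
qed

lemma DD_bracket:
  assumes "p < q" "q < r"
  shows "DD {p, q, r} z = bracket (lrow z p) (lrow z q) (lrow z r)"
proof -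
  have "sorted_list_of_set (set [p, q, r]) = [p, q, r]"
    using assms by (intro sorted_list_of_set.idem_if_sorted_distinct) auto
  then show ?thesis by (simp add: DD_def det_bracket)
qed

lemma bracket_swap: "bracket u w v = - bracket u v w" "bracket v u w = - bracket u v w"
  by (simp_all add: vec3_simps algebra_simps)

text \<open>\<open>s\<close> is the sign of the permutation that sorts the indices; the six orders
  are treated one by one.\<close>

lemma bracket_DD:
  assumes "i \<noteq> j" "j \<noteq> k" "i \<noteq> k"
  shows "\<exists>s. \<forall>z. bracket (lrow z i) (lrow z j) (lrow z k) = s * DD {i, j, k} z"
proof -
  consider "i < j \<and> j < k" | "i < k \<and> k < j" | "j < i \<and> i < k" | "j < k \<and> k < i"
    | "k < i \<and> i < j" | "k < j \<and> j < i"
    using assms by linarith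
  then show ?thesis
  proof cases
    case 1
    then show ?thesis using DD_bracket[of i j k] by (intro exI[of _ 1]) simp
  next
    case 2
    then show ?thesis using DD_bracket[of i k j]
      by (intro exI[of _ "-1"]) (simp add: bracket_swap(1)[of _ "lrow _ j"] insert_commute)
  next
    case 3
    then show ?thesis using DD_bracket[of j i k]
      by (intro exI[of _ "-1"]) (simp add: bracket_swap(2)[of "lrow _ i"] insert_commute)
  next
    case 4
    moreover have "{j, k, i} = {i, j, k}" by auto
    ultimately show ?thesis using DD_bracket[of j k i]
      by (intro exI[of _ 1]) (simp add: vec3_simps algebra_simps)
  next
    case 5
    moreover have "{k, i, j} = {i, j, k}" by auto
    ultimately show ?thesis using DD_bracket[of k i j]
      by (intro exI[of _ 1]) (simp add: vec3_simps algebra_simps)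
  next
    case 6
    moreover have "{k, j, i} = {i, j, k}" by auto
    ultimately show ?thesis using DD_bracket[of k j i]
      by (intro exI[of _ "-1"]) (simp add: vec3_simps algebra_simps)
  qed
qed

lemma finite_triples [simp]: "finite (triples n)"
  by (rule finite_subset[of _ "Pow {1..n}"]) (auto simp: triples_def)

section \<open>Monomials in C and D and their exponents\<close>

abbreviation pairs :: "nat \<Rightarrow> (nat \<times> nat) set" where
  "pairs n \<equiv> {(i, j). i \<in> {1..n} \<and> j \<in> {1..n} \<and> i \<noteq> j}"

lemma finite_pairs [simp]: "finite (pairs n)"
  by (rule finite_subset[of _ "{1..n} \<times> {1..n}"]) auto

lemma PP_add:
  "PP n (\<lambda>I. b I + b' I) (\<lambda>i j. a i j + a' i j) = (\<lambda>z\<in>MM n. PP n b a z * PP n b' a' z)"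
  by (rule ext) (simp add: PP_def power_add prod.distrib case_prod_beta)

lemma PP_zero: "PP n (\<lambda>I. 0) (\<lambda>i j. 0) = (\<lambda>z\<in>MM n. 1)"
  by (simp add: PP_def)

lemma PP_DD:
  assumes "I \<in> triples n"
  shows "PP n (\<lambda>J. of_bool (J = I)) (\<lambda>i j. 0) = (\<lambda>z\<in>MM n. DD I z)"
proof -
  have "(\<Prod>J\<in>triples n. DD J z ^ of_bool (J = I)) = (\<Prod>J\<in>triples n. if J = I then DD J z else 1)" for z
    by (intro prod.cong) auto
  then show ?thesis using assms by (simp add: PP_def)
qed

lemma PP_CC:
  assumes "(i, j) \<in> pairs n"
  shows "PP n (\<lambda>J. 0) (\<lambda>k l. of_bool (k = i \<and> l = j)) = (\<lambda>z\<in>MM n. CC i j z)"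
proof -
  have "(\<Prod>(k, l)\<in>pairs n. CC k l z ^ of_bool (k = i \<and> l = j)) =
      (\<Prod>p\<in>pairs n. if p = (i, j) then CC i j z else 1)" for z
    by (intro prod.cong) (auto simp: of_bool_def split: if_splits)
  also have "(\<Prod>p\<in>pairs n. if p = (i, j) then CC i j z else 1) = CC i j z" for z
    by (simp only: prod.delta[OF finite_pairs] assms if_True)
  finally show ?thesis by (simp add: PP_def)
qed

lemma PP_Suc_DD:
  assumes "I \<in> triples n"
  shows "PP n (\<lambda>J. b J + of_bool (J = I)) a = (\<lambda>z\<in>MM n. PP n b a z * DD I z)"
  using PP_add[of n b "\<lambda>J. of_bool (J = I)" a "\<lambda>i j. 0"]
  by (simp add: PP_DD[OF assms] cong: restrict_cong)

lemma PP_Suc_CC: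
  assumes "(i, j) \<in> pairs n"
  shows "PP n b (\<lambda>k l. a k l + of_bool (k = i \<and> l = j)) = (\<lambda>z\<in>MM n. PP n b a z * CC i j z)"
  using PP_add[of n b "\<lambda>J. 0" a "\<lambda>k l. of_bool (k = i \<and> l = j)"]
  by (simp add: PP_CC[OF assms] cong: restrict_cong)

lemma bdeg_add: "bdeg n (\<lambda>I. b I + b' I) i = bdeg n b i + bdeg n b' i"
  by (simp add: bdeg_def sum.distrib)

lemma adiv_add: "adiv n (\<lambda>i j. a i j + a' i j) i = adiv n a i + adiv n a' i"
  by (simp add: adiv_def sum.distrib)

lemma bdeg_DD: "I \<in> triples n \<Longrightarrow> bdeg n (\<lambda>J. of_bool (J = I)) i = of_bool (i \<in> I)"
  by (simp add: bdeg_def of_bool_def)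

lemma adiv_CC:
  assumes "i \<in> {1..n}" "j \<in> {1..n}"
  shows "adiv n (\<lambda>k l. of_bool (k = i \<and> l = j)) k = of_bool (k = i) - of_bool (k = j)"
  using assms by (simp add: adiv_def of_bool_def if_distrib sum.delta conj_commute cong: if_cong)

text \<open>One factor \<open>D_I\<close> or \<open>C_ij\<close> is removed at a time, and the total
  exponent drops. In this way the covariance of \<open>PP\<close> reduces to that of single
  factors.\<close>

lemma exponents_induct [consumes 1, case_names zero DD CC]:
  assumes "(b, a) \<in> exponents n"
    and zero: "P (\<lambda>I. 0) (\<lambda>i j. 0)"
    and DD: "\<And>b a I. (b, a) \<in> exponents n \<Longrightarrow> P b a \<Longrightarrow> I \<in> triples n \<Longrightarrow>
      P (\<lambda>J. b J + of_bool (J = I)) a"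
    and CC: "\<And>b a i j. (b, a) \<in> exponents n \<Longrightarrow> P b a \<Longrightarrow> (i, j) \<in> pairs n \<Longrightarrow>
      P b (\<lambda>k l. a k l + of_bool (k = i \<and> l = j))"
  shows "P b a"
  using assms(1)
proof (induction "(\<Sum>I\<in>triples n. b I) + (\<Sum>(i, j)\<in>pairs n. a i j)" arbitrary: b a)
  case 0
  then have "b I = 0" if "I \<in> triples n" for I using that by simp
  moreover have p: "\<forall>p\<in>pairs n. (case p of (i, j) \<Rightarrow> a i j) = 0"
    using 0(1) by (simp only: sum_eq_0_iff[OF finite_pairs, symmetric])
  have a0: "a i j = 0" if "(i, j) \<in> pairs n" for i j using bspec[OF p that] by simp
  ultimately have "b = (\<lambda>I. 0)"
    using 0(2) by (auto simp: exponents_def fun_eq_iff)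
  moreover have "a i j = 0" for i j
    using a0[of i j] 0(2) by (cases "(i, j) \<in> pairs n") (auto simp: exponents_def)
  then have "a = (\<lambda>i j. 0)" by (simp add: fun_eq_iff)
  ultimately have "b = (\<lambda>I. 0)" "a = (\<lambda>i j. 0)" by auto
  with zero show ?case by simp
next
  case (Suc N)
  have "(\<exists>I\<in>triples n. b I \<noteq> 0) \<or> (\<exists>(i, j)\<in>pairs n. a i j \<noteq> 0)"
  proof (rule ccontr)
    assume "\<not> ?thesis"
    then have "(\<Sum>I\<in>triples n. b I) = 0" "(\<Sum>(i, j)\<in>pairs n. a i j) = 0"
      by (auto intro!: sum.neutral)
    with Suc(2) show False by simp
  qed
  then show ?case
  proof
    assume "\<exists>I\<in>triples n. b I \<noteq> 0"
    then obtain I where I: "I \<in> triples n" "b I \<noteq> 0" by blast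
    \<comment> \<open>Subtraction on naturals is exact here because \<open>b I\<close> is
      positive.\<close>
    define b' where "b' = b(I := b I - 1)"
    have b: "b = (\<lambda>J. b' J + of_bool (J = I))" using I(2) by (auto simp: b'_def)
    have "(\<Sum>J\<in>triples n. b J) = Suc (\<Sum>J\<in>triples n. b' J)"
      using I(1) by (subst b) (simp add: sum.distrib of_bool_def)
    moreover have "(b', a) \<in> exponents n" using Suc(3) by (auto simp: exponents_def b'_def)
    ultimately have "P b' a" "(b', a) \<in> exponents n" using Suc(1,2) by auto
    then show ?thesis using DD[of b' a I] I(1) by (simp flip: b)
  next
    assume "\<exists>(i, j)\<in>pairs n. a i j \<noteq> 0"
    then obtain i j where ij: "(i, j) \<in> pairs n" "a i j \<noteq> 0" by blast
    define a' where "a' = (\<lambda>k l. a k l - of_bool (k = i \<and> l = j))"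
    have a: "a = (\<lambda>k l. a' k l + of_bool (k = i \<and> l = j))" using ij(2) by (auto simp: a'_def fun_eq_iff)
    have "(\<Sum>(k, l)\<in>pairs n. a k l) =
        (\<Sum>p\<in>pairs n. (case p of (k, l) \<Rightarrow> a' k l) + (if p = (i, j) then 1 else 0))"
      by (subst a) (intro sum.cong, auto)
    also have "\<dots> = Suc (\<Sum>(k, l)\<in>pairs n. a' k l)"
      using ij(1) by (simp only: sum.distrib sum.delta[OF finite_pairs]) simp
    finally have "(\<Sum>(k, l)\<in>pairs n. a k l) = Suc (\<Sum>(k, l)\<in>pairs n. a' k l)" .
    moreover have "(b, a') \<in> exponents n" using Suc(3) by (auto simp: exponents_def a'_def)
    ultimately have "P b a'" "(b, a') \<in> exponents n" using Suc(1,2) by auto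
    then show ?thesis using CC[of b a' i j] ij(1) by (simp flip: a)
  qed
qed

section \<open>Invariance and torus weights of the monomials\<close>

lemma sl3_act_gact: "G \<in> sl3 \<Longrightarrow> sl3_act n G z = gact n G z"
  by (simp add: sl3_act_def gact_def sl3_def matrix_inv_adj)

lemma sl3_act_MM: "G \<in> sl3 \<Longrightarrow> z \<in> MM n \<Longrightarrow> sl3_act n G z \<in> MM n"
  by (simp add: sl3_act_gact gact_MM)

lemma CC_sl3: "G \<in> sl3 \<Longrightarrow> i \<in> {1..n} \<Longrightarrow> j \<in> {1..n} \<Longrightarrow> CC i j (sl3_act n G z) = CC i j z"
  by (simp add: CC_def sl3_act_gact gact_nth scalar_product_adj_act sl3_def del: atLeastAtMost_iff)

text \<open>On cross products the adjugate acts as \<open>det g\<close> times \<open>g\<close>; one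
  further pairing gives \<open>det g ^ 2\<close>, the determinant of the adjugate.\<close>

lemma bracket_adj_act:
  "bracket (adj_act u g) (adj_act v g) (adj_act w g) = det g ^ 2 * bracket u v w"
proof -
  have cr: "cross (adj_act v g) (adj_act w g) = det g *s (g *v cross v w)"
    by (simp add: vec3_simps matrix_vector_mult_nth det_bracket algebra_simps)
  have "bracket (adj_act u g) (adj_act v g) (adj_act w g) =
      det g * scalar_product (adj_act u g) (g *v cross v w)"
    unfolding bracket_def[of "adj_act u g"] cr by (simp add: scalar_product_3 algebra_simps)
  then show ?thesis by (simp add: scalar_product_adj_act power2_eq_square bracket_def)
qed

lemma DD_sl3: "G \<in> sl3 \<Longrightarrow> I \<in> triples n \<Longrightarrow> DD I (sl3_act n G z) = DD I z"
  by (elim triplesE)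
    (simp add: DD_bracket sl3_act_gact gact_nth bracket_adj_act sl3_def del: atLeastAtMost_iff)

lemma CC_torus:
  assumes "t \<in> torus n" "i \<in> {1..n}" "j \<in> {1..n}"
  shows "CC i j (torus_act n t z) = (\<Prod>k\<in>{1..n}. t k powi (of_bool (k = j) - of_bool (k = i))) * CC i j z"
proof -
  have t: "t k \<noteq> 0" if "k \<in> {1..n}" for k using assms(1) that by (auto simp: torus_def)
  have "(\<Prod>k\<in>{1..n}. t k powi (of_bool (k = j) - of_bool (k = i))) =
      (\<Prod>k\<in>{1..n}. (if k = j then t k else 1) * (if k = i then inverse (t k) else 1))"
    using t by (intro prod.cong) (auto simp: power_int_minus)
  also have "\<dots> = t j * inverse (t i)"
    using assms by (simp add: prod.distrib)
  finally show ?thesis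
    using assms by (simp add: CC_def torus_act_nth scalar_product_scale2 del: atLeastAtMost_iff)
qed

lemma DD_torus:
  assumes "t \<in> torus n" "I \<in> triples n"
  shows "DD I (torus_act n t z) = (\<Prod>k\<in>{1..n}. t k powi (- of_bool (k \<in> I))) * DD I z"
proof -
  obtain p q r where I: "p < q" "q < r" "I = {p, q, r}" "{p, q, r} \<subseteq> {1..n}"
    using triplesE[OF assms(2)] .
  have "(\<Prod>k\<in>{1..n}. t k powi (- of_bool (k \<in> I))) = (\<Prod>k\<in>I. inverse (t k))"
    using I(4) by (intro prod.mono_neutral_cong_right) (auto simp: I(3) power_int_minus)
  also have "\<dots> = inverse (t p) * inverse (t q) * inverse (t r)"
    using I by simp
  finally show ?thesis
    using I by (simp add: DD_bracket torus_act_nth bracket_scale del: atLeastAtMost_iff)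
qed

lemma CC_poly: "i \<in> {1..n} \<Longrightarrow> j \<in> {1..n} \<Longrightarrow> (\<lambda>z\<in>MM n. CC i j z) \<in> poly_funs n"
  unfolding CC_def scalar_product_3 by (intro pfun_add pfun_mult poly_funs.row poly_funs.col)

lemma DD_poly:
  assumes "I \<in> triples n"
  shows "(\<lambda>z\<in>MM n. DD I z) \<in> poly_funs n"
proof -
  obtain p q r where I: "p < q" "q < r" "I = {p, q, r}" "{p, q, r} \<subseteq> {1..n}"
    using triplesE[OF assms] .
  have pqr: "p \<in> {1..n}" "q \<in> {1..n}" "r \<in> {1..n}" using I(4) by auto
  show ?thesis
    unfolding I(3) DD_bracket[OF I(1,2)] bracket_def scalar_product_3 cross_nth
    by (intro pfun_add pfun_mult pfun_diff poly_funs.row pqr)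
qed

text \<open>Factors contribute their weights additively. Two cases matter later: weight -3 puts
  \<open>PP\<close> into \<open>WW n\<close>, weight 0 into \<open>AA n\<close>.\<close>

lemma PP_covariant:
  assumes "(b, a) \<in> exponents n"
  shows "PP n b a \<in> poly_funs n \<and> sl3_invariant n (PP n b a) \<and>
    (\<forall>t\<in>torus n. \<forall>z\<in>MM n. PP n b a (torus_act n t z) =
      (\<Prod>i\<in>{1..n}. t i powi (- (int (bdeg n b i) + adiv n a i))) * PP n b a z)"
  using assms
proof (induction rule: exponents_induct)
  case zero
  then show ?case
    unfolding PP_zero
    by (intro conjI poly_funs.const) (auto simp: sl3_invariant_def sl3_act_MM torus_act_MM bdeg_def adiv_def)
next
  case (DD b a I)
  have I: "I \<in> triples n" using DD by blast
  have t: "t k \<noteq> 0" if "t \<in> torus n" "k \<in> {1..n}" for t k using that by (auto simp: torus_def)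
  have "PP n b a \<in> poly_funs n" using DD by blast
  then have "(\<lambda>z\<in>MM n. PP n b a z * DD I z) \<in> poly_funs n"
    by (intro pfun_mult DD_poly I) (simp add: pfun_restrict)
  moreover have "sl3_invariant n (\<lambda>z\<in>MM n. PP n b a z * DD I z)"
    using DD by (simp add: sl3_invariant_def sl3_act_MM DD_sl3)
  moreover have "(\<lambda>z\<in>MM n. PP n b a z * DD I z) (torus_act n s z) =
      (\<Prod>i\<in>{1..n}. s i powi (- (int (bdeg n (\<lambda>J. b J + of_bool (J = I)) i) + adiv n a i))) *
      (\<lambda>z\<in>MM n. PP n b a z * DD I z) z" if s: "s \<in> torus n" and z: "z \<in> MM n" for s z
  proof -
    have "(\<Prod>i\<in>{1..n}. s i powi (- (int (bdeg n (\<lambda>J. b J + of_bool (J = I)) i) + adiv n a i))) =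
       (\<Prod>i\<in>{1..n}. s i powi (- (int (bdeg n b i) + adiv n a i)) * s i powi (- of_bool (i \<in> I)))"
      using t[OF s] by (intro prod.cong refl)
        (simp add: bdeg_add bdeg_DD[OF I] algebra_simps flip: power_int_add)
    then show ?thesis
      using DD s z by (simp add: torus_act_MM DD_torus prod.distrib)
  qed
  ultimately show ?case unfolding PP_Suc_DD[OF I] by blast
next
  case (CC b a i j)
  have pair: "(i, j) \<in> pairs n" using CC by blast
  then have ij: "i \<in> {1..n}" "j \<in> {1..n}" by auto
  have t: "t k \<noteq> 0" if "t \<in> torus n" "k \<in> {1..n}" for t k using that by (auto simp: torus_def)
  have "PP n b a \<in> poly_funs n" using CC by blast
  then have "(\<lambda>z\<in>MM n. PP n b a z * CC i j z) \<in> poly_funs n"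
    by (intro pfun_mult CC_poly ij) (simp add: pfun_restrict)
  moreover have "sl3_invariant n (\<lambda>z\<in>MM n. PP n b a z * CC i j z)"
    using CC ij by (simp add: sl3_invariant_def sl3_act_MM CC_sl3)
  moreover have "(\<lambda>z\<in>MM n. PP n b a z * CC i j z) (torus_act n s z) =
      (\<Prod>k\<in>{1..n}. s k powi (- (int (bdeg n b k) + adiv n (\<lambda>k l. a k l + of_bool (k = i \<and> l = j)) k))) *
      (\<lambda>z\<in>MM n. PP n b a z * CC i j z) z" if s: "s \<in> torus n" and z: "z \<in> MM n" for s z
  proof -
    have "(\<Prod>k\<in>{1..n}. s k powi (- (int (bdeg n b k) + adiv n (\<lambda>k l. a k l + of_bool (k = i \<and> l = j)) k))) =
       (\<Prod>k\<in>{1..n}. s k powi (- (int (bdeg n b k) + adiv n a k)) *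
          s k powi (of_bool (k = j) - of_bool (k = i)))"
      using t[OF s] by (intro prod.cong refl)
        (simp add: adiv_add adiv_CC[OF ij] algebra_simps flip: power_int_add)
    then show ?thesis
      using CC ij s z by (simp add: torus_act_MM CC_torus prod.distrib)
  qed
  ultimately show ?case unfolding PP_Suc_CC[OF pair] by blast
qed

lemma prod_power_int: "(\<Prod>i\<in>S. f i powi k) = (\<Prod>i\<in>S. f i) powi k" for f :: "'a \<Rightarrow> complex"
  by (induction S rule: infinite_finite_induct) (simp_all add: power_int_mult_distrib)

lemma PP_WW:
  assumes "(b, a) \<in> admissible n"
  shows "PP n b a \<in> carrier (WW n)"
proof -
  have e: "(b, a) \<in> exponents n" and w: "\<And>i. i \<in> {1..n} \<Longrightarrow> int (bdeg n b i) + adiv n a i = 3"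
    using assms by (auto simp: admissible_def)
  have "(\<Prod>i\<in>{1..n}. t i powi (- (int (bdeg n b i) + adiv n a i))) = (\<Prod>i\<in>{1..n}. t i) powi (-3)"
    for t :: "nat \<Rightarrow> complex"
  proof -
    have "(\<Prod>i\<in>{1..n}. t i powi (- (int (bdeg n b i) + adiv n a i))) = (\<Prod>i\<in>{1..n}. t i powi (-3))"
      by (intro prod.cong refl) (simp add: w del: atLeastAtMost_iff)
    also have "\<dots> = (\<Prod>i\<in>{1..n}. t i) powi (-3)"
      by (rule prod_power_int)
    finally show ?thesis .
  qed
  with PP_covariant[OF e] show ?thesis by (simp add: WW_def torus_weight_m3_def)
qed

lemma PP_AA:
  assumes "(b, a) \<in> exponents n" "\<And>i. i \<in> {1..n} \<Longrightarrow> int (bdeg n b i) + adiv n a i = 0"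
  shows "PP n b a \<in> carrier (AA n)"
  using PP_covariant[OF assms(1)] assms(2)
  by (simp add: AA_def torus_invariant_def del: atLeastAtMost_iff)

section \<open>Module structure and spans\<close>

text \<open>Shared by \<open>AA n\<close> and \<open>WW n\<close>: the axioms hold pointwise on
  \<open>MM n\<close>, and inclusion in \<open>poly_funs n\<close> provides the extensionality that
  makes the zero function neutral.\<close>

lemma fun_abelian_group:
  fixes R :: "(point \<Rightarrow> complex, 'm) ring_scheme" (structure)
  assumes add: "add R = (\<lambda>f g. \<lambda>z\<in>MM n. f z + g z)" and zero: "zero R = (\<lambda>z\<in>MM n. 0)"
    and poly: "carrier R \<subseteq> poly_funs n" and zero_in: "zero R \<in> carrier R"
    and add_in: "\<And>f g. f \<in> carrier R \<Longrightarrow> g \<in> carrier R \<Longrightarrow> add R f g \<in> carrier R"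
    and neg_in: "\<And>f. f \<in> carrier R \<Longrightarrow> (\<lambda>z\<in>MM n. - 1 * f z) \<in> carrier R"
  shows "abelian_group R"
proof (rule abelian_groupI)
  fix f assume f: "f \<in> carrier R"
  then have "(\<lambda>z\<in>MM n. f z) = f" using poly pfun_restrict by blast
  then show "\<zero> \<oplus> f = f" by (simp add: add zero cong: restrict_cong)
  show "\<exists>h\<in>carrier R. h \<oplus> f = \<zero>"
    by (intro bexI[OF _ neg_in[OF f]]) (simp add: add zero cong: restrict_cong)
qed (auto simp: add zero_in add_in[unfolded add] algebra_simps cong: restrict_cong)

section \<open>The ring of invariants and its module\<close>

lemma AA_simps [simp]:
  "mult (AA n) f h = (\<lambda>z\<in>MM n. f z * h z)" "one (AA n) = (\<lambda>z\<in>MM n. 1)"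
  "zero (AA n) = (\<lambda>z\<in>MM n. 0)" "add (AA n) f h = (\<lambda>z\<in>MM n. f z + h z)"
  by (simp_all add: AA_def)

lemma WW_simps [simp]:
  "zero (WW n) = (\<lambda>z\<in>MM n. 0)" "add (WW n) f h = (\<lambda>z\<in>MM n. f z + h z)"
  "module.smult (WW n) f h = (\<lambda>z\<in>MM n. f z * h z)"
  by (simp_all add: WW_def)

lemma AA_iff: "f \<in> carrier (AA n) \<longleftrightarrow> f \<in> poly_funs n \<and> sl3_invariant n f \<and> torus_invariant n f"
  and WW_iff: "f \<in> carrier (WW n) \<longleftrightarrow> f \<in> poly_funs n \<and> sl3_invariant n f \<and> torus_weight_m3 n f"
  by (simp_all add: AA_def WW_def)

lemmas invariant_simps = sl3_invariant_def torus_invariant_def torus_weight_m3_def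
  sl3_act_MM torus_act_MM

lemma AA_const: "(\<lambda>z\<in>MM n. c) \<in> carrier (AA n)"
  unfolding AA_iff by (intro conjI poly_funs.const) (simp_all add: invariant_simps)

lemma AA_add: "f \<in> carrier (AA n) \<Longrightarrow> h \<in> carrier (AA n) \<Longrightarrow> (\<lambda>z\<in>MM n. f z + h z) \<in> carrier (AA n)"
  unfolding AA_iff by (intro conjI poly_funs.add) (simp_all add: invariant_simps)

lemma AA_mult: "f \<in> carrier (AA n) \<Longrightarrow> h \<in> carrier (AA n) \<Longrightarrow> (\<lambda>z\<in>MM n. f z * h z) \<in> carrier (AA n)"
  unfolding AA_iff by (intro conjI poly_funs.mult) (simp_all add: invariant_simps)

lemma WW_zero: "(\<lambda>z\<in>MM n. 0) \<in> carrier (WW n)"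
  unfolding WW_iff by (intro conjI poly_funs.const) (simp_all add: invariant_simps)

lemma WW_add: "f \<in> carrier (WW n) \<Longrightarrow> h \<in> carrier (WW n) \<Longrightarrow> (\<lambda>z\<in>MM n. f z + h z) \<in> carrier (WW n)"
  unfolding WW_iff by (intro conjI poly_funs.add) (simp_all add: invariant_simps algebra_simps)

lemma WW_smult: "f \<in> carrier (AA n) \<Longrightarrow> h \<in> carrier (WW n) \<Longrightarrow> (\<lambda>z\<in>MM n. f z * h z) \<in> carrier (WW n)"
  unfolding WW_iff AA_iff by (intro conjI poly_funs.mult) (simp_all add: invariant_simps)

lemma carrier_restrict:
  "f \<in> carrier (AA n) \<Longrightarrow> (\<lambda>z\<in>MM n. f z) = f" "f \<in> carrier (WW n) \<Longrightarrow> (\<lambda>z\<in>MM n. f z) = f"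
  by (simp_all add: AA_iff WW_iff pfun_restrict)

lemma abelian_group_AA: "abelian_group (AA n)"
proof (rule fun_abelian_group)
  fix f assume "f \<in> carrier (AA n)"
  then show "(\<lambda>z\<in>MM n. - 1 * f z) \<in> carrier (AA n)"
    using AA_mult[OF AA_const[of "-1" n], of f] by (simp cong: restrict_cong)
qed (auto simp: AA_const AA_add, auto simp: AA_iff AA_def)

lemma abelian_group_WW: "abelian_group (WW n)"
proof (rule fun_abelian_group)
  fix f assume "f \<in> carrier (WW n)"
  then show "(\<lambda>z\<in>MM n. - 1 * f z) \<in> carrier (WW n)"
    using WW_smult[OF AA_const[of "-1" n], of f] by (simp cong: restrict_cong)
qed (auto simp: WW_zero WW_add, auto simp: WW_iff WW_def)

lemma cring_AA: "cring (AA n)"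
proof (rule cringI)
  show "abelian_group (AA n)" by (rule abelian_group_AA)
  show "Group.comm_monoid (AA n)"
    by (rule comm_monoidI)
      (auto simp: AA_mult AA_const carrier_restrict mult_ac cong: restrict_cong)
qed (auto simp: algebra_simps cong: restrict_cong)

lemma module_WW: "Module.module (AA n) (WW n)"
  by (rule moduleI[OF cring_AA abelian_group_WW])
    (auto simp: WW_smult carrier_restrict algebra_simps cong: restrict_cong)

section \<open>Spans of finite sets\<close>

lemma finsum_WW:
  assumes "finite F" "\<And>x. x \<in> F \<Longrightarrow> g x \<in> carrier (WW n)"
  shows "finsum (WW n) g F = (\<lambda>z\<in>MM n. \<Sum>x\<in>F. g x z)"
proof -
  interpret abelian_group "WW n" by (rule abelian_group_WW)
  show ?thesis using assms
    by (induction F rule: finite_induct) (auto simp: Pi_iff cong: restrict_cong)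
qed

text \<open>Missing coefficients are filled with 0, so all combinations run over the same set
  \<open>S\<close> and can be added term by term.\<close>

lemma lin_span_WW_iff:
  assumes S: "finite S" "S \<subseteq> carrier (WW n)"
  shows "f \<in> lin_span (AA n) (WW n) S \<longleftrightarrow>
    (\<exists>c\<in>S \<rightarrow> carrier (AA n). f = (\<lambda>z\<in>MM n. \<Sum>x\<in>S. c x z * x z))"
proof
  assume "f \<in> lin_span (AA n) (WW n) S"
  then obtain F c where F: "finite F" "F \<subseteq> S" "c \<in> F \<rightarrow> carrier (AA n)"
    and f: "f = finsum (WW n) (\<lambda>x. module.smult (WW n) (c x) x) F"
    by (auto simp: lin_span_def)
  define c' where "c' = (\<lambda>x. if x \<in> F then c x else (\<lambda>z\<in>MM n. 0))"
  have "f = (\<lambda>z\<in>MM n. \<Sum>x\<in>F. module.smult (WW n) (c x) x z)"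
    unfolding f using F S(2) by (intro finsum_WW) (auto intro!: WW_smult)
  also have "\<dots> = (\<lambda>z\<in>MM n. \<Sum>x\<in>S. c' x z * x z)"
    using F S(1) by (intro restrict_ext sum.mono_neutral_cong_left) (auto simp: c'_def)
  finally show "\<exists>c\<in>S \<rightarrow> carrier (AA n). f = (\<lambda>z\<in>MM n. \<Sum>x\<in>S. c x z * x z)"
    using F(3) AA_const[of 0 n] by (intro bexI[of _ c']) (auto simp: c'_def Pi_iff)
next
  assume "\<exists>c\<in>S \<rightarrow> carrier (AA n). f = (\<lambda>z\<in>MM n. \<Sum>x\<in>S. c x z * x z)"
  then obtain c where c: "c \<in> S \<rightarrow> carrier (AA n)" "f = (\<lambda>z\<in>MM n. \<Sum>x\<in>S. c x z * x z)" by blast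
  have "finsum (WW n) (\<lambda>x. module.smult (WW n) (c x) x) S = (\<lambda>z\<in>MM n. \<Sum>x\<in>S. module.smult (WW n) (c x) x z)"
    using c(1) S by (intro finsum_WW) (auto intro!: WW_smult)
  then have "f = finsum (WW n) (\<lambda>x. module.smult (WW n) (c x) x) S"
    by (simp add: c(2) cong: restrict_cong)
  then show "f \<in> lin_span (AA n) (WW n) S"
    using S(1) c(1) by (auto simp: lin_span_def intro!: exI[of _ S] exI[of _ c])
qed

context
  fixes n :: nat and S :: "(point \<Rightarrow> complex) set"
  assumes S: "finite S" "S \<subseteq> carrier (WW n)"
begin

lemma lin_span_add:
  assumes "f \<in> lin_span (AA n) (WW n) S" "h \<in> lin_span (AA n) (WW n) S"
  shows "(\<lambda>z\<in>MM n. f z + h z) \<in> lin_span (AA n) (WW n) S"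
proof -
  obtain c d where c: "c \<in> S \<rightarrow> carrier (AA n)" "f = (\<lambda>z\<in>MM n. \<Sum>x\<in>S. c x z * x z)"
    and d: "d \<in> S \<rightarrow> carrier (AA n)" "h = (\<lambda>z\<in>MM n. \<Sum>x\<in>S. d x z * x z)"
    using assms by (auto simp: lin_span_WW_iff[OF S])
  show ?thesis unfolding lin_span_WW_iff[OF S]
    using c(1) d(1)
    by (intro bexI[of _ "\<lambda>x. \<lambda>z\<in>MM n. c x z + d x z"])
      (auto simp: c(2) d(2) Pi_iff sum.distrib algebra_simps intro!: AA_add cong: restrict_cong)
qed

lemma lin_span_smult:
  assumes "a \<in> carrier (AA n)" "f \<in> lin_span (AA n) (WW n) S"
  shows "(\<lambda>z\<in>MM n. a z * f z) \<in> lin_span (AA n) (WW n) S"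
proof -
  obtain c where c: "c \<in> S \<rightarrow> carrier (AA n)" "f = (\<lambda>z\<in>MM n. \<Sum>x\<in>S. c x z * x z)"
    using assms by (auto simp: lin_span_WW_iff[OF S])
  show ?thesis unfolding lin_span_WW_iff[OF S]
    using c(1) assms(1)
    by (intro bexI[of _ "\<lambda>x. \<lambda>z\<in>MM n. a z * c x z"])
      (auto simp: c(2) Pi_iff sum_distrib_left mult.assoc intro!: AA_mult cong: restrict_cong)
qed

lemma lin_span_scale:
  assumes "f \<in> lin_span (AA n) (WW n) S"
  shows "(\<lambda>z\<in>MM n. c * f z) \<in> lin_span (AA n) (WW n) S"
  using lin_span_smult[OF AA_const assms, of c] by (simp cong: restrict_cong)

lemma lin_span_zero: "(\<lambda>z\<in>MM n. 0) \<in> lin_span (AA n) (WW n) S"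
  unfolding lin_span_WW_iff[OF S]
  by (intro bexI[of _ "\<lambda>x. \<lambda>z\<in>MM n. 0"]) (auto simp: AA_const cong: restrict_cong)

lemma lin_span_base:
  assumes "f \<in> S"
  shows "f \<in> lin_span (AA n) (WW n) S"
proof -
  have "(\<lambda>z\<in>MM n. \<Sum>x\<in>S. (\<lambda>z\<in>MM n. of_bool (x = f)) z * x z) = (\<lambda>z\<in>MM n. f z)"
  proof (rule restrict_ext)
    fix z assume z: "z \<in> MM n"
    have "(\<Sum>x\<in>S. (\<lambda>z\<in>MM n. of_bool (x = f)) z * x z) = (\<Sum>x\<in>S. if x = f then f z else 0)"
      using z by (intro sum.cong) auto
    then show "(\<Sum>x\<in>S. (\<lambda>z\<in>MM n. of_bool (x = f)) z * x z) = f z"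
      using assms S(1) by simp
  qed
  also have "\<dots> = f" using assms S(2) carrier_restrict(2) by blast
  finally show ?thesis unfolding lin_span_WW_iff[OF S]
    by (intro bexI[of _ "\<lambda>x. \<lambda>z\<in>MM n. of_bool (x = f)"]) (auto simp: AA_const)
qed

lemma lin_span_subset: "lin_span (AA n) (WW n) S \<subseteq> carrier (WW n)"
proof
  fix f assume "f \<in> lin_span (AA n) (WW n) S"
  then obtain c where c: "c \<in> S \<rightarrow> carrier (AA n)" "f = (\<lambda>z\<in>MM n. \<Sum>x\<in>S. c x z * x z)"
    by (auto simp: lin_span_WW_iff[OF S])
  have "(\<lambda>z\<in>MM n. \<Sum>x\<in>T. c x z * x z) \<in> carrier (WW n)" if "T \<subseteq> S" for T
    using finite_subset[OF that S(1)] that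
  proof (induction T rule: finite_induct)
    case empty
    show ?case by (simp only: sum.empty WW_zero)
  next
    case (insert x T)
    have "(\<lambda>z\<in>MM n. c x z * x z) \<in> carrier (WW n)"
      using insert.prems c(1) S(2) by (intro WW_smult) auto
    moreover have "(\<lambda>z\<in>MM n. \<Sum>y\<in>T. c y z * y z) \<in> carrier (WW n)"
      using insert by blast
    ultimately have sum_in: "(\<lambda>z\<in>MM n. (\<lambda>z\<in>MM n. c x z * x z) z +
        (\<lambda>z\<in>MM n. \<Sum>y\<in>T. c y z * y z) z) \<in> carrier (WW n)"
      by (rule WW_add)
    have eq: "(\<lambda>z\<in>MM n. \<Sum>y\<in>insert x T. c y z * y z) =
        (\<lambda>z\<in>MM n. (\<lambda>z\<in>MM n. c x z * x z) z + (\<lambda>z\<in>MM n. \<Sum>y\<in>T. c y z * y z) z)"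
      using insert.hyps by (intro restrict_ext) simp
    show ?case unfolding eq by (rule sum_in)
  qed
  then show "f \<in> carrier (WW n)" using c(2) by blast
qed

end

section \<open>Reduced pairs\<close>

lemma Suc_mod_bij: "bij_betw (\<lambda>k. Suc k mod L) {..<L} {..<L}"
proof -
  have "inj_on (\<lambda>k. Suc k mod L) {..<L}"
    by (rule inj_onI) (auto simp: mod_Suc split: if_splits)
  moreover have "(\<lambda>k. Suc k mod L) ` {..<L} \<subseteq> {..<L}"
    by auto
  ultimately show ?thesis
    by (simp add: bij_betw_def endo_inj_surj)
qed

text \<open>The exponent matrix of \<open>Z\<^sub>\<gamma>\<close>; the remainder modulo the length
  supplies the arc from the last entry to the first.\<close>

definition cycle_exp :: "nat list \<Rightarrow> nat \<Rightarrow> nat \<Rightarrow> nat" where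
  "cycle_exp xs i j = (\<Sum>k<length xs. of_bool (i = xs ! k \<and> j = xs ! (Suc k mod length xs)))"

text \<open>Distinct entries leave each index at most one outgoing arc, so the exponents are 0 or 1
  and the cycle divides as soon as its arcs occur.\<close>

lemma cycle_exp_le:
  assumes "distinct xs" "\<And>k. k < length xs \<Longrightarrow> 0 < a (xs ! k) (xs ! (Suc k mod length xs))"
  shows "cycle_exp xs i j \<le> a i j"
proof (cases "i \<in> set xs")
  case True
  then obtain m where m: "m < length xs" "i = xs ! m" by (metis in_set_conv_nth)
  have "cycle_exp xs i j = (\<Sum>k<length xs. if k = m then of_bool (j = xs ! (Suc m mod length xs)) else 0)"
    unfolding cycle_exp_def using assms(1) m
    by (intro sum.cong refl) (auto simp: nth_eq_iff_index_eq)
  also have "\<dots> = of_bool (j = xs ! (Suc m mod length xs))" using m(1) by simp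
  also have "\<dots> \<le> a i j" using assms(2)[OF m(1)] m(2) by (simp add: Suc_leI)
  finally show ?thesis .
next
  case False
  then have "cycle_exp xs i j = 0" by (auto simp: cycle_exp_def)
  then show ?thesis by simp
qed

context
  fixes xs :: "nat list" and n :: nat
  assumes xs: "distinct xs" "set xs \<subseteq> {1..n}" "2 \<le> length xs"
begin

lemma cycle_nth: "k < length xs \<Longrightarrow> xs ! k \<in> {1..n}"
  using xs by (meson nth_mem subsetD)

lemma cycle_nth_Suc: "xs ! (Suc k mod length xs) \<in> {1..n}"
  using xs(3) by (intro cycle_nth mod_less_divisor) linarith

lemma cycle_exp_exponents: "(\<lambda>I. 0, cycle_exp xs) \<in> exponents n"
proof -
  have "i \<in> {1..n} \<and> j \<in> {1..n} \<and> i \<noteq> j" if "cycle_exp xs i j \<noteq> 0" for i j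
  proof -
    from that obtain k where k: "k < length xs" "i = xs ! k" "j = xs ! (Suc k mod length xs)"
      by (auto simp: cycle_exp_def)
    have "Suc k mod length xs < length xs" "Suc k mod length xs \<noteq> k"
      using k(1) xs(3) by (auto simp: mod_Suc)
    then have "i \<noteq> j" using xs(1) k by (metis nth_eq_iff_index_eq)
    with k cycle_nth cycle_nth_Suc show ?thesis by blast
  qed
  then show ?thesis unfolding exponents_def by blast
qed

lemma sum_cycle_exp_row: "(\<Sum>j\<in>{1..n}. cycle_exp xs i j) = (\<Sum>k<length xs. of_bool (i = xs ! k))"
proof -
  have "(\<Sum>j\<in>{1..n}. cycle_exp xs i j) =
      (\<Sum>k<length xs. \<Sum>j\<in>{1..n}. if j = xs ! (Suc k mod length xs) then of_bool (i = xs ! k) else 0)"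
    unfolding cycle_exp_def by (subst sum.swap) (intro sum.cong refl, auto)
  also have "\<dots> = (\<Sum>k<length xs. of_bool (i = xs ! k))"
    using cycle_nth_Suc by (intro sum.cong refl) (subst sum.delta, auto)
  finally show ?thesis .
qed

lemma sum_cycle_exp_column:
  "(\<Sum>j\<in>{1..n}. cycle_exp xs j i) = (\<Sum>k<length xs. of_bool (i = xs ! k))"
proof -
  have "(\<Sum>j\<in>{1..n}. cycle_exp xs j i) =
      (\<Sum>k<length xs. \<Sum>j\<in>{1..n}. if j = xs ! k then of_bool (i = xs ! (Suc k mod length xs)) else 0)"
    unfolding cycle_exp_def by (subst sum.swap) (intro sum.cong refl, auto)
  also have "\<dots> = (\<Sum>k<length xs. of_bool (i = xs ! (Suc k mod length xs)))"
    using cycle_nth by (intro sum.cong refl) (subst sum.delta, auto)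
  \<comment> \<open>Rotating the positions matches the heads of the arcs with their tails, so inflow
    equals outflow.\<close>
  also have "\<dots> = (\<Sum>k<length xs. of_bool (i = xs ! k))"
    by (rule sum.reindex_bij_betw[OF Suc_mod_bij])
  finally show ?thesis .
qed

lemma adiv_cycle_exp: "adiv n (cycle_exp xs) i = 0"
  unfolding adiv_def using sum_cycle_exp_row[of i] sum_cycle_exp_column[of i]
  by (simp flip: of_nat_sum)

lemma sum_cycle_exp: "(\<Sum>i\<in>{1..n}. \<Sum>j\<in>{1..n}. cycle_exp xs i j) = length xs"
proof -
  have "(\<Sum>i\<in>{1..n}. \<Sum>j\<in>{1..n}. cycle_exp xs i j) = (\<Sum>k<length xs. \<Sum>i\<in>{1..n}. of_bool (i = xs ! k))"
    by (simp only: sum_cycle_exp_row) (rule sum.swap)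
  also have "\<dots> = (\<Sum>k<length xs. 1)"
    using cycle_nth by (intro sum.cong refl) (auto simp: of_bool_def)
  finally show ?thesis by simp
qed

end

section \<open>Acyclicity and finiteness of reduced pairs\<close>

lemma distinct_path:
  assumes "(x, y) \<in> R\<^sup>*"
  shows "\<exists>xs. xs \<noteq> [] \<and> distinct xs \<and> hd xs = x \<and> last xs = y \<and>
    (\<forall>k. Suc k < length xs \<longrightarrow> (xs ! k, xs ! Suc k) \<in> R)"
  using assms
proof (induction rule: rtrancl_induct)
  case base
  then show ?case by (intro exI[of _ "[x]"]) auto
next
  case (step y z)
  then obtain xs where xs: "xs \<noteq> []" "distinct xs" "hd xs = x" "last xs = y"
    "\<And>k. Suc k < length xs \<Longrightarrow> (xs ! k, xs ! Suc k) \<in> R" by blast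
  show ?case
  proof (cases "z \<in> set xs")
    \<comment> \<open>A revisited vertex: the path is cut off right after its earlier visit.\<close>
    case True
    then obtain m where "m < length xs" "xs ! m = z" by (metis in_set_conv_nth)
    moreover from this have "last (take (Suc m) xs) = z" by (simp add: take_Suc_conv_app_nth)
    ultimately show ?thesis using xs
      by (intro exI[of _ "take (Suc m) xs"]) auto
  next
    case False
    have "((xs @ [z]) ! k, (xs @ [z]) ! Suc k) \<in> R" if "Suc k < length (xs @ [z])" for k
    proof (cases "Suc k < length xs")
      case True
      then show ?thesis using xs(5) by (simp add: nth_append)
    next
      case False
      then have k: "k = length xs - 1" "Suc k = length xs" using that by auto
      have "(xs @ [z]) ! k = last xs" using k xs(1) by (simp add: nth_append last_conv_nth)
      then show ?thesis using k(2) step(2) xs(4) by (simp add: nth_append)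
    qed
    with xs False show ?thesis by (intro exI[of _ "xs @ [z]"]) auto
  qed
qed

lemma exponents_support:
  "(b, a) \<in> exponents n \<Longrightarrow> 0 < a u v \<Longrightarrow> u \<in> {1..n} \<and> v \<in> {1..n} \<and> u \<noteq> v"
  unfolding exponents_def mem_Collect_eq case_prod_conv by (metis less_irrefl)

lemma reduced_iff: "(b, a) \<in> reduced n \<longleftrightarrow> (b, a) \<in> admissible n \<and>
    \<not> (\<exists>is. distinct is \<and> set is \<subseteq> {1..n} \<and> 2 \<le> length is \<and>
      (\<forall>k<length is. 0 < a (is ! k) (is ! (Suc k mod length is))))"
  unfolding reduced_def mem_Collect_eq case_prod_conv by (rule refl)

lemma admissible_iff: "(b, a) \<in> admissible n \<longleftrightarrow> (b, a) \<in> exponents n \<and>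
    (\<Sum>I\<in>triples n. b I) = n \<and> (\<forall>i\<in>{1..n}. int (bdeg n b i) + adiv n a i = 3)"
  unfolding admissible_def mem_Collect_eq case_prod_conv by (rule refl)

text \<open>The arc from \<open>i\<close> to \<open>j\<close> would close a path from
  \<open>j\<close> back to \<open>i\<close> to a cycle.\<close>

lemma reduced_acyclic:
  assumes red: "(b, a) \<in> reduced n" and ij: "0 < a i j"
  shows "(j, i) \<notin> {(u, v). 0 < a u v}\<^sup>*"
proof
  let ?R = "{(u, v). 0 < a u v}"
  assume "(j, i) \<in> ?R\<^sup>*"
  then obtain xs where xs: "xs \<noteq> []" "distinct xs" "hd xs = j" "last xs = i"
    "\<And>k. Suc k < length xs \<Longrightarrow> 0 < a (xs ! k) (xs ! Suc k)"
    using distinct_path[of j i ?R] by auto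
  have ex: "u \<in> {1..n} \<and> v \<in> {1..n} \<and> u \<noteq> v" if "0 < a u v" for u v
    using red that exponents_support unfolding reduced_iff admissible_iff by blast
  \<comment> \<open>The diagonal of \<open>a\<close> is zero, so \<open>i\<close> and
    \<open>j\<close> differ and the path has at least two vertices.\<close>
  have len: "2 \<le> length xs"
  proof (rule ccontr)
    assume "\<not> 2 \<le> length xs"
    with xs(1) have "length xs = 1" by (auto simp: not_le less_2_cases_iff)
    with xs(3,4) have "i = j" by (cases xs) auto
    with ex[OF ij] show False by blast
  qed
  have arc: "0 < a (xs ! k) (xs ! (Suc k mod length xs))" if "k < length xs" for k
  proof (cases "Suc k = length xs")
    case True
    then have "xs ! k = i" using xs(1,4) by (metis diff_Suc_1 last_conv_nth)
    moreover have "xs ! 0 = j" using xs(1,3) by (simp add: hd_conv_nth)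
    ultimately show ?thesis using ij True by simp
  next
    case False
    then show ?thesis using xs(5)[of k] that by simp
  qed
  have "set xs \<subseteq> {1..n}"
    using arc ex by (metis in_set_conv_nth subsetI)
  with xs(2) len arc red show False unfolding reduced_iff by blast
qed

text \<open>The sum of the divergences over the set \<open>U\<close> of all predecessors of \<open>i\<close> is the total flow out
  of \<open>U\<close>, which includes the arc from \<open>i\<close> to \<open>j\<close>.\<close>

lemma reduced_bound:
  assumes red: "(b, a) \<in> reduced n"
  shows "a i j \<le> 3 * n"
proof (cases "0 < a i j")
  case True
  let ?R = "{(u, v). 0 < a u v}"
  define U where "U = {u \<in> {1..n}. (u, i) \<in> ?R\<^sup>*}"
  have adm: "(b, a) \<in> admissible n" using red by (simp add: reduced_iff)
  then have ex: "u \<in> {1..n} \<and> v \<in> {1..n} \<and> u \<noteq> v" if "0 < a u v" for u v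
    using that exponents_support unfolding admissible_iff by blast
  have i: "i \<in> U" and j: "j \<in> {1..n} - U"
    using ex[OF True] reduced_acyclic[OF red True] by (auto simp: U_def)
  have U: "U \<subseteq> {1..n}" "finite U" by (auto simp: U_def)
  \<comment> \<open>\<open>U\<close> contains all predecessors of its elements, so no flow enters
    it.\<close>
  have pred: "a v u = 0" if "u \<in> U" "v \<in> {1..n} - U" for u v
  proof (rule ccontr)
    assume "a v u \<noteq> 0"
    then have "(v, u) \<in> ?R" by simp
    with that show False by (auto simp: U_def intro: converse_rtrancl_into_rtrancl)
  qed
  have split: "(\<Sum>v\<in>{1..n}. f v) = (\<Sum>v\<in>U. f v) + (\<Sum>v\<in>{1..n} - U. f v)" for f :: "nat \<Rightarrow> int"
    using U by (metis add.commute finite_atLeastAtMost sum.subset_diff)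
  have "int (a i j) \<le> (\<Sum>v\<in>{1..n} - U. int (a i v))"
    using j by (intro member_le_sum) auto
  also have "\<dots> \<le> (\<Sum>u\<in>U. \<Sum>v\<in>{1..n} - U. int (a u v))"
    using i U(2) by (intro member_le_sum) (auto intro: sum_nonneg)
  also have "\<dots> = (\<Sum>u\<in>U. adiv n a u)"
  proof -
    have "(\<Sum>v\<in>{1..n} - U. int (a v u)) = 0" if "u \<in> U" for u using pred[OF that] by simp
    then have "(\<Sum>u\<in>U. adiv n a u) = (\<Sum>u\<in>U. (\<Sum>v\<in>U. int (a u v)) + (\<Sum>v\<in>{1..n} - U. int (a u v))
        - (\<Sum>v\<in>U. int (a v u)))"
      unfolding adiv_def split by (intro sum.cong) auto
    \<comment> \<open>Arcs inside \<open>U\<close> are counted once as outflow and once as inflow,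
      and cancel.\<close>
    also have "\<dots> = (\<Sum>u\<in>U. \<Sum>v\<in>{1..n} - U. int (a u v))"
      using sum.swap[of "\<lambda>u v. int (a u v)" U U] by (simp add: sum.distrib sum_subtractf)
    finally show ?thesis by simp
  qed
  \<comment> \<open>\<open>bdeg\<close> is nonnegative, so admissibility bounds each divergence by
    3.\<close>
  also have "\<dots> \<le> (\<Sum>u\<in>U. 3)"
  proof (rule sum_mono)
    fix u assume "u \<in> U"
    then have "int (bdeg n b u) + adiv n a u = 3" using adm U(1) unfolding admissible_iff by blast
    then show "adiv n a u \<le> 3" by simp
  qed
  also have "\<dots> \<le> 3 * int n"
    using card_mono[OF _ U(1)] by simp
  finally show ?thesis by simp
qed simp

text \<open>The entries of \<open>b\<close> are bounded by their sum \<open>n\<close>, those of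
  \<open>a\<close> by \<open>3 * n\<close>, and both vanish off finite index sets.\<close>

lemma finite_reduced: "finite (reduced n)"
proof -
  define B where "B = {b :: nat set \<Rightarrow> nat. \<forall>I. (I \<in> triples n \<longrightarrow> b I \<in> {..n}) \<and>
    (I \<notin> triples n \<longrightarrow> b I = 0)}"
  define A where "A = {f :: nat \<times> nat \<Rightarrow> nat. \<forall>p. (p \<in> pairs n \<longrightarrow> f p \<in> {..3 * n}) \<and>
    (p \<notin> pairs n \<longrightarrow> f p = 0)}"
  have B: "finite B" unfolding B_def by (rule finite_set_of_finite_funs) auto
  have A: "finite A" unfolding A_def by (rule finite_set_of_finite_funs[OF finite_pairs]) auto
  have "reduced n \<subseteq> B \<times> curry ` A"
  proof (rule subrelI)
    fix b a assume red: "(b, a) \<in> reduced n"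
    then have ex: "(b, a) \<in> exponents n" and sum: "(\<Sum>I\<in>triples n. b I) = n"
      unfolding reduced_iff admissible_iff by blast+
    have bI: "b I \<le> n" if "I \<in> triples n" for I
      using member_le_sum[OF that, of b] sum by simp
    have bB: "b \<in> B" using ex bI unfolding B_def by (auto simp: exponents_def)
    have "case_prod a \<in> A"
      using ex reduced_bound[OF red] unfolding A_def by (auto simp: exponents_def)
    then have aA: "a \<in> curry ` A" by (rule rev_image_eqI) simp
    show "(b, a) \<in> B \<times> curry ` A" by (rule SigmaI[OF bB aA])
  qed
  then show ?thesis
    by (rule finite_subset[OF _ finite_cartesian_product[OF B finite_imageI[OF A]]])
qed

section \<open>Splitting off cycles\<close>

abbreviation reduced_PP :: "nat \<Rightarrow> (point \<Rightarrow> complex) set" where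
  "reduced_PP n \<equiv> {PP n b a | b a. (b, a) \<in> reduced n}"

lemma reduced_PP: "finite (reduced_PP n)" "reduced_PP n \<subseteq> carrier (WW n)"
proof -
  have "reduced_PP n = (\<lambda>(b, a). PP n b a) ` reduced n" by auto
  then show "finite (reduced_PP n)" using finite_reduced by simp
  show "reduced_PP n \<subseteq> carrier (WW n)" using PP_WW unfolding reduced_iff by blast
qed

text \<open>A cycle has divergence 0: removing it keeps the pair admissible, its monomial lies in
  \<open>AA n\<close>, and the total of \<open>a\<close> drops by its length, so the induction ends
  at reduced pairs.\<close>

lemma admissible_PP_in_span:
  assumes "(b, a) \<in> admissible n"
  shows "PP n b a \<in> lin_span (AA n) (WW n) (reduced_PP n)"
  using assms
proof (induction "\<Sum>i\<in>{1..n}. \<Sum>j\<in>{1..n}. a i j" arbitrary: a rule: less_induct)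
  case less
  show ?case
  proof (cases "(b, a) \<in> reduced n")
    case True
    then show ?thesis by (intro lin_span_base[OF reduced_PP]) blast
  next
    case False
    then obtain xs where xs: "distinct xs" "set xs \<subseteq> {1..n}" "2 \<le> length xs"
      "\<And>k. k < length xs \<Longrightarrow> 0 < a (xs ! k) (xs ! (Suc k mod length xs))"
      using less.prems unfolding reduced_iff by blast
    define c where "c = cycle_exp xs"
    define a' where "a' = (\<lambda>i j. a i j - c i j)"
    have a: "a = (\<lambda>i j. a' i j + c i j)"
      using cycle_exp_le[of xs a, OF xs(1,4)] by (auto simp: a'_def c_def fun_eq_iff)
    have c: "(\<lambda>I. 0, c) \<in> exponents n" "adiv n c i = 0" for i
      unfolding c_def using cycle_exp_exponents adiv_cycle_exp xs by blast+
    have "adiv n a i = adiv n a' i" for i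
      by (subst a) (simp add: adiv_add c)
    then have adm: "(b, a') \<in> admissible n"
      using less.prems unfolding admissible_iff by (simp add: exponents_def a'_def)
    have "(\<Sum>i\<in>{1..n}. \<Sum>j\<in>{1..n}. a i j) = (\<Sum>i\<in>{1..n}. \<Sum>j\<in>{1..n}. a' i j) + length xs"
      unfolding sum_cycle_exp[OF xs(1-3), symmetric] c_def[symmetric]
      by (subst a) (simp add: sum.distrib)
    then have "(\<Sum>i\<in>{1..n}. \<Sum>j\<in>{1..n}. a' i j) < (\<Sum>i\<in>{1..n}. \<Sum>j\<in>{1..n}. a i j)"
      using xs(3) by linarith
    then have IH: "PP n b a' \<in> lin_span (AA n) (WW n) (reduced_PP n)"
      using adm by (rule less.hyps)
    have "PP n (\<lambda>I. 0) c \<in> carrier (AA n)"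
      using c by (intro PP_AA) (simp_all add: bdeg_def)
    moreover have "PP n b a = (\<lambda>z\<in>MM n. PP n (\<lambda>I. 0) c z * PP n b a' z)"
      using PP_add[of n b "\<lambda>I. 0" a' c] by (simp add: mult.commute flip: a)
    ultimately show ?thesis using lin_span_smult[OF reduced_PP] IH by simp
  qed
qed

section \<open>Eliminating the brackets of columns\<close>

definition D_free :: "sym multiset \<Rightarrow> bool" where "D_free m \<longleftrightarrow> (\<forall>i j k. SD i j k \<notin># m)"
definition E_free :: "sym multiset \<Rightarrow> bool" where "E_free m \<longleftrightarrow> (\<forall>i j k. SE i j k \<notin># m)"

lemma sum_of_bool_eq: "(i::nat) \<in> {1..n} \<Longrightarrow> (\<Sum>l\<in>{1..n}. of_bool (l = i) :: int) = 1"
  by (simp only: of_bool_def sum.delta[OF finite_atLeastAtMost] if_True)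

text \<open>Summed over all indices, a \<open>C\<close> weighs 0 and an \<open>E\<close> has
  nonnegative weight; only a \<open>D\<close> is negative.\<close>

lemma D_free_weight:
  assumes "m \<in> monomials n" "D_free m"
  shows "0 \<le> (\<Sum>l\<in>{1..n}. mwt m l)"
  using assms
proof (induction m)
  case (add s m)
  have "0 \<le> (\<Sum>l\<in>{1..n}. swt s l)"
  proof (cases s)
    case (SC i j)
    with add.prems have "i \<in> {1..n}" "j \<in> {1..n}" by auto
    then show ?thesis by (simp only: SC swt.simps sum_subtractf sum_of_bool_eq)
  next
    case (SD i j k)
    with add.prems(2) show ?thesis by (auto simp: D_free_def)
  next
    case (SE i j k)
    then show ?thesis by (intro sum_nonneg) simp
  qed
  moreover have "0 \<le> (\<Sum>l\<in>{1..n}. mwt m l)" using add by (auto simp: D_free_def)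
  ultimately show ?case by (simp add: sum.distrib)
qed simp

text \<open>Each triple is counted once for each of its three elements. With \<open>sum_adiv\<close>
  this derives \<open>|b| = n\<close> from the weight conditions.\<close>

lemma sum_bdeg: "(\<Sum>i\<in>{1..n}. bdeg n b i) = 3 * (\<Sum>I\<in>triples n. b I)"
proof -
  have "(\<Sum>i\<in>{1..n}. bdeg n b i) = (\<Sum>i\<in>{1..n}. \<Sum>I\<in>triples n. if i \<in> I then b I else 0)"
    unfolding bdeg_def by (rule sum.cong[OF refl]) (rule sum.inter_filter[OF finite_triples])
  also have "\<dots> = (\<Sum>I\<in>triples n. \<Sum>i\<in>{1..n}. if i \<in> I then b I else 0)"
    by (rule sum.swap)
  also have "\<dots> = (\<Sum>I\<in>triples n. 3 * b I)"
  proof (intro sum.cong refl)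
    fix I assume "I \<in> triples n"
    then have "{i \<in> {1..n}. i \<in> I} = I" "card I = 3" by (auto simp: triples_def)
    then show "(\<Sum>i\<in>{1..n}. if i \<in> I then b I else 0) = 3 * b I"
      using sum.inter_filter[of "{1..n}" "\<lambda>i. b I" "\<lambda>i. i \<in> I"] by simp
  qed
  finally show ?thesis by (simp add: sum_distrib_left)
qed

lemma sum_adiv: "(\<Sum>i\<in>{1..n}. adiv n a i) = 0"
  unfolding adiv_def sum_subtractf using sum.swap[of "\<lambda>i j. int (a i j)" "{1..n}" "{1..n}"] by simp

text \<open>The first alternative arises from \<open>C_ii\<close>, zero on \<open>MM n\<close>, and
  from a \<open>D\<close> with a repeated index; \<open>s\<close> collects the signs from sorting
  the other determinants.\<close>

lemma E_free_PP:
  assumes "m \<in> monomials n" "E_free m"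
  shows "(\<forall>z\<in>MM n. mev m z = 0) \<or> (\<exists>b a s. (b, a) \<in> exponents n \<and>
    (\<forall>z\<in>MM n. mev m z = s * PP n b a z) \<and>
    (\<forall>i\<in>{1..n}. int (bdeg n b i) + adiv n a i = - mwt m i))"
  using assms
proof (induction m)
  case empty
  show ?case
    by (intro disjI2 exI[of _ "\<lambda>I. 0"] exI[of _ "\<lambda>i j. 0"] exI[of _ 1])
      (auto simp: exponents_def PP_zero bdeg_def adiv_def)
next
  case (add s m)
  show ?case
  proof (cases "\<forall>z\<in>MM n. mev m z = 0")
    case True
    then show ?thesis by simp
  next
    case False
    have "m \<in> monomials n" "E_free m" using add.prems by (simp_all add: E_free_def)
    with False obtain b a c where ba: "(b, a) \<in> exponents n" "\<And>z. z \<in> MM n \<Longrightarrow> mev m z = c * PP n b a z"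
      "\<And>i. i \<in> {1..n} \<Longrightarrow> int (bdeg n b i) + adiv n a i = - mwt m i"
      using add.IH by blast
    show ?thesis
    proof (cases s)
      case (SC i j)
      with add.prems have ij: "i \<in> {1..n}" "j \<in> {1..n}" by auto
      show ?thesis
      proof (cases "i = j")
        case True
        then have "mev (add_mset s m) z = 0" if "z \<in> MM n" for z
          using MM_D[OF that ij(1)] by (simp add: SC CC_def)
        then show ?thesis by blast
      next
        case False
        with ij have pair: "(i, j) \<in> pairs n" by auto
        let ?a = "\<lambda>k l. a k l + of_bool (k = i \<and> l = j)"
        have "(b, ?a) \<in> exponents n" using ba(1) pair by (auto simp: exponents_def)
        moreover have "mev (add_mset s m) z = c * PP n b ?a z" if "z \<in> MM n" for z
          unfolding PP_Suc_CC[OF pair] using ba(2)[OF that] that by (simp add: SC)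
        moreover have "int (bdeg n b l) + adiv n ?a l = - mwt (add_mset s m) l" if "l \<in> {1..n}" for l
          using ba(3)[OF that] by (simp add: SC adiv_add adiv_CC[OF ij])
        ultimately show ?thesis by blast
      qed
    next
      case (SD i j k)
      with add.prems have ijk: "i \<in> {1..n}" "j \<in> {1..n}" "k \<in> {1..n}" by auto
      show ?thesis
      proof (cases "i \<noteq> j \<and> j \<noteq> k \<and> i \<noteq> k")
        case False
        then have "bracket (lrow z i) (lrow z j) (lrow z k) = 0" for z
          by (auto simp: vec3_simps algebra_simps)
        then show ?thesis by (simp add: SD)
      next
        case True
        then obtain e where e: "\<And>z. bracket (lrow z i) (lrow z j) (lrow z k) = e * DD {i, j, k} z"
          using bracket_DD[of i j k] by blast
        have I: "{i, j, k} \<in> triples n" using True ijk by (auto simp: triples_def)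
        let ?b = "\<lambda>J. b J + of_bool (J = {i, j, k})"
        have "(?b, a) \<in> exponents n" using ba(1) I by (auto simp: exponents_def)
        moreover have "mev (add_mset s m) z = (e * c) * PP n ?b a z" if "z \<in> MM n" for z
          unfolding PP_Suc_DD[OF I] using ba(2)[OF that] that by (simp add: SD e)
        moreover have "int (bdeg n ?b l) + adiv n a l = - mwt (add_mset s m) l" if "l \<in> {1..n}" for l
          using ba(3)[OF that] True by (auto simp: SD bdeg_add bdeg_DD[OF I])
        ultimately show ?thesis by blast
      qed
    next
      case (SE i j k)
      with add.prems show ?thesis by (auto simp: E_free_def)
    qed
  qed
qed

text \<open>The product of a determinant of rows and one of columns is the determinant of the 3 by 3
  matrix of pairings, here written out.\<close>

lemma bracket_mult_bracket:
  "sev (SE i j k) z * sev (SD p q r) z =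
    CC p i z * (CC q j z * CC r k z) - CC p i z * (CC q k z * CC r j z)
    - CC p j z * (CC q i z * CC r k z) + CC p j z * (CC q k z * CC r i z)
    + CC p k z * (CC q i z * CC r j z) - CC p k z * (CC q j z * CC r i z)"
proof -
  define L where "L = (vector [lrow z p, lrow z q, lrow z r] :: complex^3^3)"
  define M where "M = (vector [Acol z i, Acol z j, Acol z k] :: complex^3^3)"
  have LM: "(L ** transpose M) $ a $ b = scalar_product (L $ a) (M $ b)" for a b
    by (simp add: matrix_matrix_mult_def transpose_def scalar_product_def)
  have "det L = sev (SD p q r) z" "det M = sev (SE i j k) z"
    by (simp_all add: det_bracket L_def M_def)
  then have "sev (SE i j k) z * sev (SD p q r) z = det (L ** transpose M)"
    by (simp only: det_mul det_transpose mult.commute)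
  moreover have "L $ 1 = lrow z p" "L $ 2 = lrow z q" "L $ 3 = lrow z r"
    "M $ 1 = Acol z i" "M $ 2 = Acol z j" "M $ 3 = Acol z k"
    by (simp_all add: L_def M_def)
  ultimately show ?thesis
    by (simp only: det_3 LM CC_def[symmetric]) (simp only: algebra_simps)
qed

abbreviation E_count :: "sym multiset \<Rightarrow> nat" where
  "E_count m \<equiv> size {#s \<in># m. \<exists>i j k. s = SE i j k#}"

text \<open>Replacing one \<open>E\<close> and one \<open>D\<close> by three \<open>C\<close> keeps
  the weight and lowers the number of \<open>E\<close>.\<close>

lemma weight_m3_in_span:
  assumes n: "1 \<le> n" and m: "m \<in> weight_m3 n"
  shows "(\<lambda>z\<in>MM n. mev m z) \<in> lin_span (AA n) (WW n) (reduced_PP n)"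
  using m
proof (induction "E_count m" arbitrary: m rule: less_induct)
  case less
  have mon: "m \<in> monomials n" and wt: "\<And>i. i \<in> {1..n} \<Longrightarrow> mwt m i = -3"
    using less.prems by (auto simp: weight_m3_def)
  note add = lin_span_add[OF reduced_PP] and scale = lin_span_scale[OF reduced_PP]
  show ?case
  proof (cases "E_free m")
    case True
    with E_free_PP[OF mon] consider "\<forall>z\<in>MM n. mev m z = 0"
      | b a s where "(b, a) \<in> exponents n" "\<And>z. z \<in> MM n \<Longrightarrow> mev m z = s * PP n b a z"
          "\<And>i. i \<in> {1..n} \<Longrightarrow> int (bdeg n b i) + adiv n a i = - mwt m i"
      by blast
    then show ?thesis
    proof cases
      case 1
      then show ?thesis using lin_span_zero[OF reduced_PP] by (simp cong: restrict_cong)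
    next
      case (2 b a s)
      have d: "int (bdeg n b i) + adiv n a i = 3" if "i \<in> {1..n}" for i
        using 2(3)[OF that] wt[OF that] by simp
      \<comment> \<open>Summing the weight conditions gives \<open>3 * |b| = 3 * n\<close>, as the
        divergences cancel.\<close>
      have "int (\<Sum>i\<in>{1..n}. bdeg n b i) + (\<Sum>i\<in>{1..n}. adiv n a i) = (\<Sum>i\<in>{1..n}. 3)"
        unfolding of_nat_sum sum.distrib[symmetric] by (intro sum.cong d refl)
      then have "(\<Sum>I\<in>triples n. b I) = n"
        unfolding sum_bdeg sum_adiv by (simp del: of_nat_sum)
      then have "(b, a) \<in> admissible n" using 2(1) d unfolding admissible_iff by blast
      from scale[OF admissible_PP_in_span[OF this], of s] show ?thesis
        using 2(2) by (simp cong: restrict_cong)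
    qed
  next
    case False
    then obtain i j k where E: "SE i j k \<in># m" unfolding E_free_def by blast
    \<comment> \<open>The total weight is \<open>-3 * n\<close>, which is negative, so some
      \<open>D\<close> must be present.\<close>
    have "\<not> D_free m"
    proof
      assume "D_free m"
      from D_free_weight[OF mon this] have "0 \<le> (\<Sum>l\<in>{1..n}. mwt m l)" .
      also have "\<dots> = (\<Sum>l\<in>{1..n}. -3)" by (intro sum.cong wt refl)
      finally show False using n by simp
    qed
    then obtain p q r where D: "SD p q r \<in># m" unfolding D_free_def by blast
    obtain m1 where m1: "m = add_mset (SE i j k) m1" using mset_add[OF E] .
    with D obtain m' where m': "m1 = add_mset (SD p q r) m'" by (auto dest: multi_member_split)
    have m: "m = add_mset (SE i j k) (add_mset (SD p q r) m')" by (simp add: m1 m')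
    \<comment> \<open>The monomials of the six terms in \<open>bracket_mult_bracket\<close>, with
      \<open>(x, y, w)\<close> running over the permutations of \<open>(i, j, k)\<close>.\<close>
    define T where "T x y w = add_mset (SC p x) (add_mset (SC q y) (add_mset (SC r w) m'))" for x y w
    have T: "(\<lambda>z\<in>MM n. mev (T x y w) z) \<in> lin_span (AA n) (WW n) (reduced_PP n)"
      if xyw: "{x, y, w} = {i, j, k}" "\<And>l. swt (SE x y w) l = swt (SE i j k) l" for x y w
    proof (rule less.hyps)
      show "E_count (T x y w) < E_count m" by (simp add: m T_def)
      have "T x y w \<in> monomials n"
        using mon xyw(1) by (auto simp: m T_def)
      moreover have "mwt (T x y w) l = mwt m l" for l
        using xyw(2)[of l] by (simp add: m T_def)
      ultimately show "T x y w \<in> weight_m3 n" using wt by (simp add: weight_m3_def)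
    qed
    have perms: "(\<lambda>z\<in>MM n. mev (T i j k) z) \<in> lin_span (AA n) (WW n) (reduced_PP n)"
      "(\<lambda>z\<in>MM n. mev (T i k j) z) \<in> lin_span (AA n) (WW n) (reduced_PP n)"
      "(\<lambda>z\<in>MM n. mev (T j i k) z) \<in> lin_span (AA n) (WW n) (reduced_PP n)"
      "(\<lambda>z\<in>MM n. mev (T j k i) z) \<in> lin_span (AA n) (WW n) (reduced_PP n)"
      "(\<lambda>z\<in>MM n. mev (T k i j) z) \<in> lin_span (AA n) (WW n) (reduced_PP n)"
      "(\<lambda>z\<in>MM n. mev (T k j i) z) \<in> lin_span (AA n) (WW n) (reduced_PP n)"
      by (rule T; auto)+
    have eq: "mev m z = mev (T i j k) z + (-1) * mev (T i k j) z + (-1) * mev (T j i k) z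
      + mev (T j k i) z + mev (T k i j) z + (-1) * mev (T k j i) z" for z
    proof -
      have "mev m z = (sev (SE i j k) z * sev (SD p q r) z) * mev m' z" by (simp add: m)
      then show ?thesis unfolding bracket_mult_bracket by (simp add: T_def algebra_simps)
    qed
    have span_add: "(\<lambda>z\<in>MM n. f z + h z) \<in> lin_span (AA n) (WW n) (reduced_PP n)"
      if "(\<lambda>z\<in>MM n. f z) \<in> lin_span (AA n) (WW n) (reduced_PP n)"
        "(\<lambda>z\<in>MM n. h z) \<in> lin_span (AA n) (WW n) (reduced_PP n)" for f h
      using add[OF that] by (simp cong: restrict_cong)
    have span_scale: "(\<lambda>z\<in>MM n. c * f z) \<in> lin_span (AA n) (WW n) (reduced_PP n)"
      if "(\<lambda>z\<in>MM n. f z) \<in> lin_span (AA n) (WW n) (reduced_PP n)" for f c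
      using scale[OF that] by (simp cong: restrict_cong)
    show ?thesis unfolding eq by (intro span_add span_scale perms)
  qed
qed

section \<open>Generation of the whole module\<close>

lemma WW_in_span:
  assumes n: "1 \<le> n" and H: "H \<in> carrier (WW n)"
  shows "H \<in> lin_span (AA n) (WW n) (reduced_PP n)"
proof -
  obtain xs where xs: "snd ` set xs \<subseteq> weight_m3 n" "\<And>z. z \<in> MM n \<Longrightarrow> H z = lincomb xs z"
    using WW_lincomb[OF H] by blast
  have "(\<lambda>z\<in>MM n. lincomb xs z) \<in> lin_span (AA n) (WW n) (reduced_PP n)"
    using xs(1)
  proof (induction xs)
    case Nil
    show ?case unfolding lincomb_simps by (rule lin_span_zero[OF reduced_PP])
  next
    case (Cons x xs)
    obtain c m where x: "x = (c, m)" by force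
    have "m \<in> weight_m3 n" using Cons.prems by (simp add: x)
    from lin_span_scale[OF reduced_PP weight_m3_in_span[OF n this], of c]
    have cm: "(\<lambda>z\<in>MM n. c * mev m z) \<in> lin_span (AA n) (WW n) (reduced_PP n)"
      by (simp cong: restrict_cong)
    have xs: "(\<lambda>z\<in>MM n. lincomb xs z) \<in> lin_span (AA n) (WW n) (reduced_PP n)"
      using Cons.prems by (intro Cons.IH) auto
    have eq: "(\<lambda>z\<in>MM n. lincomb (x # xs) z) =
        (\<lambda>z\<in>MM n. (\<lambda>z\<in>MM n. c * mev m z) z + (\<lambda>z\<in>MM n. lincomb xs z) z)"
      by (rule restrict_ext) (simp add: x)
    show ?case unfolding eq by (rule lin_span_add[OF reduced_PP cm xs])
  qed
  moreover have "(\<lambda>z\<in>MM n. lincomb xs z) = H"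
    using xs(2) carrier_restrict(2)[OF H] by (metis restrict_ext)
  ultimately show ?thesis by simp
qed

theorem theorem4p2:
  fixes n :: nat
  assumes "3 \<le> n"
  shows "fin_gen_module (AA n) (WW n) \<and>
    (\<forall>(b, a) \<in> reduced n. PP n b a \<in> carrier (WW n)) \<and>
    carrier (WW n) = lin_span (AA n) (WW n) {PP n b a | b a. (b, a) \<in> reduced n}"
proof -
  have span: "carrier (WW n) = lin_span (AA n) (WW n) (reduced_PP n)"
    using WW_in_span[of n] assms lin_span_subset[OF reduced_PP] by auto
  have "fin_gen_module (AA n) (WW n)"
    unfolding fin_gen_module_def
    by (intro conjI module_WW exI[of _ "reduced_PP n"] reduced_PP span)
  moreover have "\<forall>(b, a) \<in> reduced n. PP n b a \<in> carrier (WW n)"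
  proof clarify
    fix b a assume "(b, a) \<in> reduced n"
    then show "PP n b a \<in> carrier (WW n)" using PP_WW unfolding reduced_iff by blast
  qed
  ultimately show ?thesis using span by (intro conjI)
qed

end
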